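(* There are infinitely many prime spectral eigenvalues of the spectral pair $(\mu_{N,B},\Lambda_{N,L})$, where $$\Lambda_{N,L}=\left\{\sum_{k=0}^{n}\ell_kN^k:\ n\in\mathbb{N},\ \ell_0,\ell_1,\dots,\ell_n\in L\right\},$$ in each of the following cases. (i) $N=2q$ with $q$ an integer, $q\ge 2$, $B=\{0,1\}$, and $L=\{0,q\}$ or $L=\{-q,0\}$. (ii) $N=3q$ with $q$ an integer, $q\ge 2$, $B=\{0,a,b\}\subset\mathbb{Z}$ with $\gcd(a,b)=1$ and $\{a,b\}\equiv\{1,2\}\pmod 3$, and $L=\{0,q,2q\}$, $L=\{-q,0,q\}$, or $L=\{-2q,-q,0\}$. (iii) $B=\{0,\,a,\,2^mb,\,a+2^mb'\}$ where $m\in\mathbb{N}$, $a,b,b'\in\mathbb{N}$ are odd integers with $\gcd(a,b,b')=1$, $N\ge 8$ is an integer with $2^{m+1}\mid N$, and $L=\frac{N}{2^{m+1}}\{0,1,2^m,1+2^m\}$.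
   Context: $\mathbb{N}=\{1,2,3,\dots\}$, and $\#A$ denotes the cardinality of a set $A$. For a Borel probability measure $\mu$ on $\mathbb{R}$ and a countable set $\Lambda\subset\mathbb{R}$, $(\mu,\Lambda)$ is a spectral pair (and $\Lambda$ is a spectrum of $\mu$) if $\{e_\lambda(x)=e^{2\pi \mathrm{i}\lambda x}:\lambda\in\Lambda\}$ is an orthonormal basis of $L^2(\mu)$. A real number $t$ is a spectral eigenvalue of the spectral pair $(\mu,\Lambda)$ if $(\mu,t\Lambda)$ is also a spectral pair. For an integer $N\ge 2$ and a finite set $B\subset\mathbb{Z}$, $\mu_{N,B}$ is the self-similar measure, i.e. the unique Borel probability measure $\mu$ on $\mathbb{R}$ satisfying $\mu=\frac{1}{\#B}\sum_{b\in B}\mu\circ\tau_b^{-1}$, where $\tau_b(x)=(x+b)/N$. *)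

theory Defs
  imports "HOL-Probability.Probability" "HOL-Computational_Algebra.Primes"
begin

definition square_integrable :: "'a measure \<Rightarrow> ('a \<Rightarrow> complex) \<Rightarrow> bool" where
  "square_integrable M f \<longleftrightarrow>
     f \<in> borel_measurable M \<and> integrable M (\<lambda>x. (cmod (f x))\<^sup>2)"

definition L2_inner :: "'a measure \<Rightarrow> ('a \<Rightarrow> complex) \<Rightarrow> ('a \<Rightarrow> complex) \<Rightarrow> complex" where
  "L2_inner M f g = (LINT x|M. f x * cnj (g x))"

definition L2_norm :: "'a measure \<Rightarrow> ('a \<Rightarrow> complex) \<Rightarrow> real" where
  "L2_norm M f = sqrt (LINT x|M. (cmod (f x))\<^sup>2)"

text \<open>
  \<open>L\<^sup>2(M)\<close> is represented by functions rather than by almost-everywhere classes.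
  An orthonormal basis is a Hilbert-space basis: an orthonormal family whose finite
  linear combinations are dense. It is indexed, so different indices
  must give different (indeed orthogonal) elements of \<open>L\<^sup>2(M)\<close>.
\<close>
definition L2_orthonormal_basis :: "'a measure \<Rightarrow> ('i \<Rightarrow> 'a \<Rightarrow> complex) \<Rightarrow> 'i set \<Rightarrow> bool" where
  "L2_orthonormal_basis M e I \<longleftrightarrow>
     (\<forall>i\<in>I. square_integrable M (e i)) \<and>
     (\<forall>i\<in>I. \<forall>j\<in>I. L2_inner M (e i) (e j) = (if i = j then 1 else 0)) \<and>
     (\<forall>f. square_integrable M f \<longrightarrow>
        (\<forall>\<epsilon>>0. \<exists>F c. finite F \<and> F \<subseteq> I \<and>
           L2_norm M (\<lambda>x. f x - (\<Sum>i\<in>F. c i * e i x)) < \<epsilon>))"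

definition expo :: "real \<Rightarrow> real \<Rightarrow> complex" where
  "expo \<xi> x = exp (2 * complex_of_real pi * \<i> * complex_of_real \<xi> * complex_of_real x)"

definition borel_prob :: "real measure \<Rightarrow> bool" where
  "borel_prob \<mu> \<longleftrightarrow> prob_space \<mu> \<and> sets \<mu> = sets borel"

definition spectral_pair :: "real measure \<Rightarrow> real set \<Rightarrow> bool" where
  "spectral_pair \<mu> \<Lambda> \<longleftrightarrow>
     borel_prob \<mu> \<and> countable \<Lambda> \<and> L2_orthonormal_basis \<mu> expo \<Lambda>"

definition spectral_eigenvalue :: "real measure \<Rightarrow> real set \<Rightarrow> real \<Rightarrow> bool" where
  "spectral_eigenvalue \<mu> \<Lambda> t \<longleftrightarrow>
     spectral_pair \<mu> \<Lambda> \<and> spectral_pair \<mu> ((*) t ` \<Lambda>)"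

definition ifs_map :: "int \<Rightarrow> int \<Rightarrow> real \<Rightarrow> real" where
  "ifs_map N b x = (x + of_int b) / of_int N"

definition is_self_similar :: "int \<Rightarrow> int set \<Rightarrow> real measure \<Rightarrow> bool" where
  "is_self_similar N B \<mu> \<longleftrightarrow>
     borel_prob \<mu> \<and>
     (\<forall>A\<in>sets borel.
        measure \<mu> A = 1 / real (card B) * (\<Sum>b\<in>B. measure \<mu> (ifs_map N b -` A)))"

text \<open>
  By Hutchinson's theorem the description below is proper whenever \<open>N \<ge> 2\<close> and \<open>B\<close>
  is finite and nonempty; only such parameters are meaningful.
\<close>
definition self_similar_measure :: "int \<Rightarrow> int set \<Rightarrow> real measure" where
  "self_similar_measure N B = (THE \<mu>. is_self_similar N B \<mu>)"

definition Lambda_set :: "int \<Rightarrow> int set \<Rightarrow> real set" where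
  "Lambda_set N L =
     {of_int (\<Sum>k=0..n. l k * N ^ k) | (n :: nat) (l :: nat \<Rightarrow> int).
        1 \<le> n \<and> (\<forall>k\<in>{0..n}. l k \<in> L)}"

end

theory Submission
  imports Defs "HOL-Number_Theory.Residues"
begin

text \<open>
  Write \<open>m(x)\<close> for the average of \<open>exp (2 \<pi> i b x)\<close> over \<open>b \<in> B\<close>. A Hadamard triple \<open>(N, B, L)\<close> satisfies
  \<open>\<Sum>l\<in>L. |m((x + l)/N)|\<^sup>2 = 1\<close>. The squared length of the projection of the exponential with frequency
  \<open>- x\<close> onto the span of the frequencies with at most \<open>n\<close> digits is \<open>Q n x\<close>; it increases to a fixed point of the
  corresponding averaging operator. If this limit is below 1 somewhere, the points where it is minimal
  on a compact interval form a set that is invariant under all branches \<open>x \<mapsto> (x + l)/N\<close> of positive weight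
  and does not contain 0. Dividing repeatedly by \<open>N\<close> would lead to 0, so each of its points meets a zero
  of \<open>m\<close> this way, and the set is finite. As paths of equal length have distinct end points,
  some point has a single live branch forever, whose weight is then 1; this gives a
  cycle of nonzero integers \<open>x \<mapsto> (x + l)/N\<close>. So \<open>\<Lambda>\<close> is a spectrum unless there is such a cycle.

  For the digits \<open>p L\<close> with \<open>p\<close> prime, a cycle is closed under multiplication by \<open>N\<close> modulo \<open>p\<close>. There are infinitely
  many primes \<open>p\<close> for which some power of \<open>N\<close> is 2 modulo \<open>p\<close>. For these the cycle is closed under doubling, hence
  visits both \<open>(p/4, p/2)\<close> and \<open>(p/2, 3p/4)\<close> modulo \<open>p\<close>, but the digits confine it to a set that misses one
  of these intervals.
\<close>

section \<open>Doubling modulo primes\<close>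

text \<open>A variant of Euclid's argument. If there were finitely many such primes with product
  \<open>M\<close>, Euler's theorem modulo \<open>A * M\<close> would give
  \<open>N ^ (2 + \<phi>) - 2 = d * A * (1 + e * M * s)\<close>, and a prime factor of the last
  factor is a new such prime.\<close>

lemma infinite_primes_two_power:
  fixes N :: int
  assumes "N \<ge> 3"
  shows "infinite {p::nat. prime p \<and> \<not> int p dvd N \<and> (\<exists>k. [N ^ k = 2] (mod int p))}"
    (is "infinite ?P")
proof
  assume fin: "finite ?P"
  \<comment> \<open>Dividing by \<open>d\<close> removes the common factor 2 of \<open>N\<close> and
    \<open>N ^ 2 - 2\<close>; what is left, \<open>A\<close>, is odd and coprime to
    \<open>N\<close>.\<close>
  define d :: int where "d = (if even N then 2 else 1)"
  define A where "A = (N ^ 2 - 2) div d"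
  define M where "M = (\<Prod>p\<in>?P. int p)"
  have dA: "N ^ 2 - 2 = d * A" by (auto simp: A_def d_def)
  \<comment> \<open>Every prime factor of \<open>N\<close> divides \<open>e\<close>, so none of them
    can divide \<open>1 + e * M * s\<close>.\<close>
  obtain e where e: "N ^ 2 = d * e" "even N \<Longrightarrow> N dvd e"
  proof (cases "even N")
    case True
    then obtain c where "N = 2 * c" by auto
    then show ?thesis using that[of "c * N"] True by (auto simp: d_def power2_eq_square)
  next
    case False
    then show ?thesis using that[of "N ^ 2"] by (auto simp: d_def)
  qed
  have oddA: "odd A"
  proof (cases "even N")
    case True
    then obtain c where c: "N = 2 * c" by auto
    then have "A = 2 * c ^ 2 - 1" using True by (auto simp: A_def d_def power2_eq_square)
    then show ?thesis by simp
  qed (auto simp: A_def d_def)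
  have Apos: "A > 0"
  proof -
    have "N ^ 2 \<ge> 3 ^ 2" using assms by (intro power_mono) auto
    then have "d * A > 0" using dA by simp
    then show ?thesis by (auto simp: d_def zero_less_mult_iff split: if_splits)
  qed
  have copA: "coprime N A"
  proof (rule ccontr)
    assume "\<not> coprime N A"
    moreover have "gcd N A \<noteq> 0" using assms by simp
    ultimately obtain p where "prime p" "p dvd gcd N A"
      using prime_divisor_exists[of "gcd N A"] by (auto simp: coprime_iff_gcd_eq_1)
    then have p: "prime p" "p dvd N" "p dvd A" by auto
    have "p dvd N ^ 2 - 2" using p(3) dA by simp
    moreover have "p dvd N ^ 2" using p(2) by (simp add: power2_eq_square)
    ultimately have "p dvd N ^ 2 - (N ^ 2 - 2)" by (rule dvd_diff[rotated])
    then have "p dvd 2" by simp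
    then have "p = 2" using p(1) primes_dvd_imp_eq two_is_prime by blast
    then show False using p(3) oddA by simp
  qed
  have copM: "coprime N M"
    unfolding M_def
  proof (rule prod_coprime_right)
    fix p assume "p \<in> ?P"
    then show "coprime N (int p)"
      using prime_imp_coprime[of "int p" N] by (simp add: coprime_commute)
  qed
  have Mpos: "M > 0" unfolding M_def by (intro prod_pos) (auto simp: prime_gt_0_nat)
  define \<phi> where "\<phi> = totient (nat (A * M))"
  have AM: "A * M > 0" using Apos Mpos by simp
  have "coprime N (A * M)" using copA copM by simp
  then have "coprime (nat N) (nat (A * M))"
    using assms AM by (simp add: coprime_int_iff [symmetric])
  then have "[nat N ^ \<phi> = 1] (mod nat (A * M))" unfolding \<phi>_def by (rule euler_theorem)
  then have "[int (nat N ^ \<phi>) = int 1] (mod int (nat (A * M)))" by (simp only: cong_int_iff)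
  then have "[N ^ \<phi> = 1] (mod (A * M))" using assms AM by simp
  then obtain s where s: "N ^ \<phi> - 1 = A * M * s"
    by (metis cong_iff_dvd_diff dvdE)
  have "\<phi> > 0" unfolding \<phi>_def using AM by simp
  then have "N ^ 1 \<le> N ^ \<phi>" using assms by (intro power_increasing) auto
  then have "A * M * s > 0" using s assms by simp
  then have spos: "s > 0" using AM by (simp add: zero_less_mult_iff)
  have epos: "e > 0" using e(1) assms
    by (smt (verit) d_def zero_less_mult_iff zero_less_power)
  define X where "X = 1 + e * M * s"
  have eq: "N ^ (2 + \<phi>) - 2 = d * A * X"
  proof -
    have "N ^ (2 + \<phi>) - 2 = N ^ 2 * (N ^ \<phi> - 1) + (N ^ 2 - 2)"
      by (simp add: power_add power2_eq_square algebra_simps)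
    also have "\<dots> = (d * e) * (A * M * s) + d * A" unfolding s dA by (simp only: e(1))
    also have "\<dots> = d * A * X" unfolding X_def by (simp add: algebra_simps)
    finally show ?thesis .
  qed
  have "X > 1" unfolding X_def using epos Mpos spos by simp
  then obtain q where q: "prime q" "q dvd X"
    using prime_divisor_exists[of X] by (auto simp: zdvd1_eq)
  define p where "p = nat q"
  have pq: "int p = q" using q(1) by (simp add: p_def prime_ge_0_int)
  have "\<not> q dvd N"
  proof
    assume N: "q dvd N"
    have "q dvd e"
    proof (cases "even N")
      case True
      then show ?thesis using e(2) N dvd_trans by blast
    next
      case False
      then show ?thesis using e(1) N by (metis d_def dvd_mult mult_1 power2_eq_square)
    qed
    then have "q dvd e * M * s" by simp
    then have "q dvd 1" using q(2) unfolding X_def by (simp only: dvd_add_left_iff)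
    then show False using q(1) not_prime_unit by blast
  qed
  moreover have "[N ^ (2 + \<phi>) = 2] (mod q)"
    using eq q(2) by (simp add: cong_iff_dvd_diff)
  then have "\<exists>k. [N ^ k = 2] (mod q)" by blast
  ultimately have "p \<in> ?P" using q(1) pq by (auto simp flip: prime_int_iff)
  then have "int p dvd M" unfolding M_def using fin by (intro dvd_prodI) auto
  then have "q dvd e * M * s" using pq by simp
  then have "q dvd 1" using q(2) unfolding X_def by (simp only: dvd_add_left_iff)
  then show False using q(1) not_prime_unit by blast
qed

text \<open>The largest residue below p/2 that occurs must exceed p/4, since otherwise its double
  would be a larger one below p/2.\<close>

lemma doubling_residue_low:
  fixes p z :: int and S :: "int set"
  assumes p: "odd p" "p > 0"
    and dbl: "\<And>y. y \<in> S \<Longrightarrow> \<exists>x\<in>S. [x = 2 * y] (mod p)"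
    and z: "z \<in> S" "\<not> p dvd z"
  shows "\<exists>y\<in>S. p < 4 * (y mod p) \<and> 2 * (y mod p) < p"
proof -
  let ?r = "\<lambda>y. y mod p"
  have r: "0 \<le> ?r y" "?r y < p" for y using p by auto
  have ne: "2 * ?r y \<noteq> p" for y using p(1) by (metis dvd_triv_left)
  have step: "\<exists>x\<in>S. \<not> p dvd x \<and> ?r x = (2 * ?r y) mod p" if y: "y \<in> S" "\<not> p dvd y" for y
  proof -
    obtain x where x: "x \<in> S" "[x = 2 * y] (mod p)" using dbl y(1) by blast
    have "coprime p 2" using p(1) by simp
    then have "\<not> p dvd 2 * y" using y(2) by (simp add: coprime_dvd_mult_right_iff)
    then have "\<not> p dvd x" using x(2) by (simp add: cong_dvd_iff)
    then show ?thesis using x by (auto simp: cong_def mod_mult_right_eq)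
  qed
  \<comment> \<open>Some residue lies below p/2: otherwise the least residue r would have the
    smaller successor 2r - p.\<close>
  obtain y where y: "y \<in> S" "\<not> p dvd y" "2 * ?r y < p"
  proof (rule ccontr)
    assume "\<not> thesis"
    then have high: "2 * ?r y > p" if "y \<in> S" "\<not> p dvd y" for y
      using that ne[of y] \<open>\<And>y. y \<in> S \<Longrightarrow> \<not> p dvd y \<Longrightarrow> 2 * (y mod p) < p \<Longrightarrow> thesis\<close>
      by (meson linorder_neqE_linordered_idom)
    obtain y where y: "y \<in> S" "\<not> p dvd y"
      and min: "\<And>x. x \<in> S \<and> \<not> p dvd x \<Longrightarrow> nat (?r y) \<le> nat (?r x)"
      using exists_least_iff[of "\<lambda>n. \<exists>y. y \<in> S \<and> \<not> p dvd y \<and> n = nat (?r y)"] z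
      by (metis linorder_not_le)
    obtain x where x: "x \<in> S" "\<not> p dvd x" "?r x = (2 * ?r y) mod p" using step y by blast
    have "(2 * ?r y) mod p = (2 * ?r y - p) mod p" by simp
    also have "\<dots> = 2 * ?r y - p" using high[OF y] r(2)[of y] by (intro mod_pos_pos_trivial) auto
    finally have "?r x < ?r y" using x(3) r(2)[of y] by simp
    then show False using min[of x] x r(1)[of y] r(1)[of x] by simp
  qed
  let ?W = "{y \<in> S. \<not> p dvd y \<and> 2 * ?r y < p}"
  have "finite (?r ` ?W)" by (rule finite_subset[of _ "{0..<p}"]) (use r in auto)
  then have W: "Max (?r ` ?W) \<in> ?r ` ?W" "\<And>x. x \<in> ?W \<Longrightarrow> ?r x \<le> Max (?r ` ?W)"
    using y by (blast intro: Max_in, auto intro: Max_ge)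
  then obtain y where y: "y \<in> S" "\<not> p dvd y" "2 * ?r y < p"
    and max: "\<And>x. x \<in> ?W \<Longrightarrow> ?r x \<le> ?r y" by auto
  obtain x where x: "x \<in> S" "\<not> p dvd x" "?r x = (2 * ?r y) mod p" using step y by blast
  have "(2 * ?r y) mod p = 2 * ?r y" using y r by (intro mod_pos_pos_trivial) auto
  then have rx: "?r x = 2 * ?r y" using x by simp
  have "?r y > 0" using y(2) r(1)[of y] by (simp add: dvd_eq_mod_eq_0 order_less_le)
  then have "\<not> 2 * ?r x < p" using max[of x] x rx by auto
  then have "p < 4 * ?r y" using rx ne[of x] by auto
  then show ?thesis using y by blast
qed

text \<open>Negation preserves closure under doubling and exchanges the two quarters next to
  p/2.\<close>

lemma doubling_residue_high:
  fixes p z :: int and S :: "int set"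
  assumes p: "odd p" "p > 0"
    and dbl: "\<And>y. y \<in> S \<Longrightarrow> \<exists>x\<in>S. [x = 2 * y] (mod p)"
    and z: "z \<in> S" "\<not> p dvd z"
  shows "\<exists>y\<in>S. p < 2 * (y mod p) \<and> 4 * (y mod p) < 3 * p"
proof -
  have "\<exists>y\<in>uminus ` S. p < 4 * (y mod p) \<and> 2 * (y mod p) < p"
  proof (rule doubling_residue_low[OF p, of _ "- z"])
    fix y assume "y \<in> uminus ` S"
    then obtain y' where y': "y' \<in> S" "y = - y'" by auto
    then obtain x where "x \<in> S" "[x = 2 * y'] (mod p)" using dbl by blast
    then show "\<exists>x\<in>uminus ` S. [x = 2 * y] (mod p)" using y'
      by (intro bexI[of _ "- x"]) (auto simp: cong_minus_minus_iff)
  qed (use z in auto)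
  then obtain y where y: "y \<in> S" "p < 4 * (- y mod p)" "2 * (- y mod p) < p" by auto
  then have "- y mod p = p - y mod p"
    using p(2) by (auto simp: zmod_zminus1_eq_if split: if_splits)
  then show ?thesis using y by auto
qed

text \<open>A nonempty invariant subset of least cardinality works. Surjectivity is what later
  supplies predecessors inside a cycle.\<close>

lemma finite_self_map_image_eq:
  assumes "finite S" "S \<noteq> {}" "f ` S \<subseteq> S"
  shows "\<exists>C\<subseteq>S. C \<noteq> {} \<and> f ` C = C"
proof -
  obtain C where C: "C \<subseteq> S \<and> C \<noteq> {} \<and> f ` C \<subseteq> C"
    and min: "\<And>D. D \<subseteq> S \<and> D \<noteq> {} \<and> f ` D \<subseteq> D \<Longrightarrow> card C \<le> card D"
    using exists_least_iff[of "\<lambda>n. \<exists>C. (C \<subseteq> S \<and> C \<noteq> {} \<and> f ` C \<subseteq> C) \<and> n = card C"] assms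
    by (metis linorder_not_le subset_refl)
  have fin: "finite C" using C assms(1) finite_subset by blast
  have "f ` C \<subseteq> S \<and> f ` C \<noteq> {} \<and> f ` (f ` C) \<subseteq> f ` C" using C by blast
  then have "card C \<le> card (f ` C)" by (rule min)
  then have "f ` C = C" using C fin by (simp add: card_seteq)
  then show ?thesis using C by blast
qed

section \<open>The self-similar measure and its Fourier transform\<close>

lemma expo_eq_cis: "expo \<xi> x = cis (2 * pi * \<xi> * x)"
  by (simp add: expo_def cis_conv_exp algebra_simps)

lemma expo_add: "expo (a + b) x = expo a x * expo b x"
  by (simp add: expo_eq_cis cis_mult algebra_simps)

lemma expo_add_right: "expo a (x + y) = expo a x * expo a y"
  by (simp add: expo_eq_cis cis_mult algebra_simps)

lemma expo_0 [simp]: "expo 0 x = 1" "expo a 0 = 1"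
  by (simp_all add: expo_eq_cis)

lemma norm_expo [simp]: "cmod (expo a x) = 1"
  by (simp add: expo_eq_cis)

lemma cnj_expo: "cnj (expo a x) = expo (- a) x"
  by (simp add: expo_eq_cis cis_cnj)

lemma expo_divide: "expo a (x / c) = expo (a / c) x"
  by (simp add: expo_eq_cis)

lemma expo_commute: "expo a x = expo x a"
  by (simp add: expo_eq_cis mult_ac)

lemma expo_eq_1_iff: "expo a x = 1 \<longleftrightarrow> a * x \<in> \<int>"
proof -
  have "expo a x = 1 \<longleftrightarrow> (\<exists>n::int. 2 * pi * a * x = of_int (2 * n) * pi)"
    unfolding expo_def exp_eq_1 by simp
  also have "\<dots> \<longleftrightarrow> (\<exists>n::int. a * x = of_int n)"
    by (intro ex_cong1) simp
  also have "\<dots> \<longleftrightarrow> a * x \<in> \<int>" by (metis Ints_cases Ints_of_int)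
  finally show ?thesis .
qed

lemma continuous_expo [continuous_intros]:
  "continuous_on S f \<Longrightarrow> continuous_on S g \<Longrightarrow> continuous_on S (\<lambda>x. expo (f x) (g x))"
  unfolding expo_def by (intro continuous_intros)

lemma borel_measurable_expo [measurable]: "expo a \<in> borel_measurable borel"
  by (intro borel_measurable_continuous_onI continuous_intros)

section \<open>The Fourier transform, the mask of the digit set, and the self-similar
  measure\<close>

definition fourier :: "real measure \<Rightarrow> real \<Rightarrow> complex" where
  "fourier \<mu> \<xi> = (LINT x|\<mu>. expo \<xi> x)"

text \<open>This is the Fourier transform of the uniform distribution on \<open>B\<close>.\<close>

definition ifs_mask :: "int set \<Rightarrow> real \<Rightarrow> complex" where
  "ifs_mask B x = (\<Sum>b\<in>B. expo x (of_int b)) / of_nat (card B)"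

lemma fourier_eq_char: "fourier \<mu> \<xi> = char \<mu> (2 * pi * \<xi>)"
  by (simp add: fourier_def char_def expo_def mult_ac)

lemma borel_prob_iff: "borel_prob \<mu> \<longleftrightarrow> real_distribution \<mu>"
  by (simp add: borel_prob_def real_distribution_def real_distribution_axioms_def)

lemma continuous_fourier:
  assumes "borel_prob \<mu>"
  shows "continuous_on S (fourier \<mu>)"
proof -
  interpret real_distribution \<mu> using assms by (simp add: borel_prob_iff)
  have "continuous_on UNIV (char \<mu>)"
    using isCont_char continuous_at_imp_continuous_on by blast
  then have "continuous_on UNIV (\<lambda>\<xi>. char \<mu> (2 * pi * \<xi>))"
    by (rule continuous_on_compose2) (auto intro: continuous_intros)
  then show ?thesis unfolding fourier_eq_char[abs_def] using continuous_on_subset by blast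
qed

lemma continuous_mask: "continuous_on S (ifs_mask B)"
  unfolding ifs_mask_def divide_inverse by (intro continuous_intros)

lemma mask_add_int: "k \<in> \<int> \<Longrightarrow> ifs_mask B (x + k) = ifs_mask B x"
  unfolding ifs_mask_def expo_add by (intro arg_cong2[where f = "(/)"] sum.cong refl)
    (auto simp: expo_eq_1_iff)

lemma mask_int: "finite B \<Longrightarrow> B \<noteq> {} \<Longrightarrow> k \<in> \<int> \<Longrightarrow> ifs_mask B k = 1"
  using mask_add_int[of k B 0] by (simp add: ifs_mask_def)

text \<open>Self-similarity says that \<open>\<mu>\<close> is the law of
  \<open>ifs_map N b x\<close> for independent \<open>b\<close>, uniform on \<open>B\<close>, and
  \<open>x\<close> of law \<open>\<mu>\<close>; Fubini then splits the integral. The bound makes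
  everything integrable.\<close>

lemma self_similar_integral:
  fixes f :: "real \<Rightarrow> complex"
  assumes ss: "is_self_similar N B \<mu>" and B: "finite B" "B \<noteq> {}"
    and f [measurable]: "f \<in> borel_measurable borel" and bdd: "\<And>x. cmod (f x) \<le> K"
  shows "(LINT x|\<mu>. f x) = (\<Sum>b\<in>B. LINT x|\<mu>. f (ifs_map N b x)) / of_nat (card B)"
proof -
  interpret M: real_distribution \<mu> using ss by (simp add: is_self_similar_def borel_prob_iff)
  define P where "P = measure_pmf (pmf_of_set B)"
  interpret P: prob_space P unfolding P_def by (rule measure_pmf.prob_space_axioms)
  interpret PM: pair_prob_space P \<mu> ..
  have [measurable]: "(\<lambda>(b, x). ifs_map N b x) \<in> borel_measurable (P \<Otimes>\<^sub>M \<mu>)"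
  proof -
    have "(\<lambda>(b, x). ifs_map N b x) \<in> borel_measurable (count_space UNIV \<Otimes>\<^sub>M \<mu>)"
      by (rule measurable_pair_measure_countable1) (auto simp: ifs_map_def)
    moreover have "sets (P \<Otimes>\<^sub>M \<mu>) = sets (count_space UNIV \<Otimes>\<^sub>M \<mu>)"
      by (intro sets_pair_measure_cong) (auto simp: P_def)
    ultimately show ?thesis using measurable_cong_sets by blast
  qed
  have [measurable]: "ifs_map N b \<in> borel_measurable borel" for b
    unfolding ifs_map_def[abs_def] by measurable
  have eq: "\<mu> = distr (P \<Otimes>\<^sub>M \<mu>) borel (\<lambda>(b, x). ifs_map N b x)"
  proof (rule measure_eqI)
    fix A assume "A \<in> sets \<mu>"
    then have A [measurable]: "A \<in> sets borel" by simp
    have V: "ifs_map N b -` A \<in> sets borel" for b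
      using measurable_sets[of "ifs_map N b" borel borel A] by simp
    have "emeasure \<mu> A = ennreal (1 / real (card B) * (\<Sum>b\<in>B. measure \<mu> (ifs_map N b -` A)))"
      using ss A by (simp add: is_self_similar_def M.emeasure_eq_measure)
    also have "\<dots> = (\<integral>\<^sup>+b. emeasure \<mu> (ifs_map N b -` A) \<partial>P)"
      unfolding P_def using B
      by (simp add: nn_integral_pmf_of_set M.emeasure_eq_measure sum_ennreal
          divide_ennreal sum_nonneg card_gt_0_iff ennreal_of_nat_eq_real_of_nat)
    also have "\<dots> = emeasure (P \<Otimes>\<^sub>M \<mu>) ((\<lambda>(b, x). ifs_map N b x) -` A \<inter> space (P \<Otimes>\<^sub>M \<mu>))"
    proof (subst M.emeasure_pair_measure_alt)
      show "(\<lambda>(b, x). ifs_map N b x) -` A \<inter> space (P \<Otimes>\<^sub>M \<mu>) \<in> sets (P \<Otimes>\<^sub>M \<mu>)"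
        by measurable
    qed (auto intro!: nn_integral_cong arg_cong[where f = "emeasure \<mu>"] simp: space_pair_measure P_def)
    also have "\<dots> = emeasure (distr (P \<Otimes>\<^sub>M \<mu>) borel (\<lambda>(b, x). ifs_map N b x)) A"
      by (subst emeasure_distr) auto
    finally show "emeasure \<mu> A = \<dots>" .
  qed simp
  have meas: "(\<lambda>(b, x). f (ifs_map N b x)) \<in> borel_measurable (P \<Otimes>\<^sub>M \<mu>)"
    using measurable_compose[OF \<open>(\<lambda>(b, x). ifs_map N b x) \<in> borel_measurable (P \<Otimes>\<^sub>M \<mu>)\<close> f]
    by (simp add: split_beta')
  have "(LINT x|\<mu>. f x) = (LINT z|(P \<Otimes>\<^sub>M \<mu>). f ((\<lambda>(b, x). ifs_map N b x) z))"
    by (subst (1) eq, subst integral_distr) auto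
  also have "\<dots> = (LINT z|(P \<Otimes>\<^sub>M \<mu>). (\<lambda>(b, x). f (ifs_map N b x)) z)"
    by (simp add: split_beta')
  also have "\<dots> = (LINT b|P. LINT x|\<mu>. f (ifs_map N b x))"
    by (subst PM.integral_fst'[symmetric])
       (use bdd meas in \<open>auto intro!: PM.P.integrable_const_bound[of _ K]\<close>)
  also have "\<dots> = (\<Sum>b\<in>B. (1 / real (card B)) *\<^sub>R (LINT x|\<mu>. f (ifs_map N b x)))"
    unfolding P_def using B by (subst integral_measure_pmf[of B]) auto
  also have "\<dots> = (\<Sum>b\<in>B. LINT x|\<mu>. f (ifs_map N b x)) / of_nat (card B)"
    by (simp add: scaleR_conv_of_real sum_divide_distrib)
  finally show ?thesis .
qed

lemma fourier_self_similar:
  assumes ss: "is_self_similar N B \<mu>" and B: "finite B" "B \<noteq> {}"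
  shows "fourier \<mu> \<xi> = ifs_mask B (\<xi> / of_int N) * fourier \<mu> (\<xi> / of_int N)"
proof -
  have "expo \<xi> (ifs_map N b x) = expo (\<xi> / of_int N) (of_int b) * expo (\<xi> / of_int N) x" for b x
    by (simp add: ifs_map_def expo_divide expo_add_right)
  then show ?thesis
    unfolding fourier_def ifs_mask_def
    by (subst self_similar_integral[OF ss B, of _ 1]) (auto simp: sum_distrib_right)
qed

text \<open>The difference d of the two Fourier transforms satisfies |d(t)| \<le> |d(t/N)|, is
  continuous, and vanishes at 0; iterating gives d = 0, and characteristic functions determine the
  law.\<close>

lemma self_similar_unique:
  assumes N: "N \<ge> 2" and B: "finite B" "B \<noteq> {}"
    and ss: "is_self_similar N B \<mu>" "is_self_similar N B \<nu>"
  shows "\<mu> = \<nu>"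
proof -
  interpret M: real_distribution \<mu> using ss by (simp add: is_self_similar_def borel_prob_iff)
  interpret V: real_distribution \<nu> using ss by (simp add: is_self_similar_def borel_prob_iff)
  have mask_le: "cmod (ifs_mask B x) \<le> 1" for x
  proof -
    have "cmod (\<Sum>b\<in>B. expo x (of_int b)) \<le> real (card B)"
      by (rule order_trans[OF norm_sum]) simp
    then show ?thesis using B by (simp add: ifs_mask_def norm_divide divide_le_eq card_gt_0_iff)
  qed
  define d where "d \<xi> = fourier \<mu> \<xi> - fourier \<nu> \<xi>" for \<xi>
  have step: "cmod (d \<xi>) \<le> cmod (d (\<xi> / of_int N))" for \<xi>
  proof -
    have "d \<xi> = ifs_mask B (\<xi> / of_int N) * d (\<xi> / of_int N)"
      unfolding d_def fourier_self_similar[OF ss(1) B, of \<xi>] fourier_self_similar[OF ss(2) B, of \<xi>]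
      by (simp add: algebra_simps)
    then show ?thesis using mask_le by (simp add: norm_mult mult_left_le_one_le)
  qed
  have bound: "cmod (d \<xi>) \<le> cmod (d (\<xi> / of_int N ^ n))" for \<xi> n
  proof (induction n)
    case (Suc n)
    then show ?case using step[of "\<xi> / of_int N ^ n"] by (simp add: mult.commute)
  qed simp
  have "d \<xi> = 0" for \<xi>
  proof -
    have "(\<lambda>n. \<xi> * (1 / of_int N) ^ n) \<longlonglongrightarrow> \<xi> * 0"
      using N by (intro tendsto_intros LIMSEQ_power_zero) auto
    then have "(\<lambda>n. \<xi> / of_int N ^ n) \<longlonglongrightarrow> 0" by (simp add: power_one_over)
    moreover have "isCont d 0"
      unfolding d_def[abs_def]
      using continuous_fourier[of \<mu> UNIV] continuous_fourier[of \<nu> UNIV] ss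
      by (auto intro!: continuous_diff simp: is_self_similar_def continuous_on_eq_continuous_at)
    ultimately have "(\<lambda>n. d (\<xi> / of_int N ^ n)) \<longlonglongrightarrow> d 0"
      by (rule isCont_tendsto_compose[rotated])
    moreover have "d 0 = 0" by (simp add: d_def fourier_eq_char M.char_zero V.char_zero)
    ultimately have "(\<lambda>n. cmod (d (\<xi> / of_int N ^ n))) \<longlonglongrightarrow> 0"
      using tendsto_norm_zero by fastforce
    then have "cmod (d \<xi>) \<le> 0" by (rule LIMSEQ_le_const) (use bound in auto)
    then show ?thesis by simp
  qed
  then have "char \<mu> t = char \<nu> t" for t
    using fourier_eq_char[of \<mu> "t / (2 * pi)"] fourier_eq_char[of \<nu> "t / (2 * pi)"]
    by (simp add: d_def)
  then show ?thesis
    by (intro Levy_uniqueness M.real_distribution_axioms V.real_distribution_axioms) auto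
qed

text \<open>The measure is the law of the random series of digits times powers of 1/N, with
  independent digits uniform on \<open>B\<close>. Splitting off the first digit gives
  self-similarity, and the series is uniformly bounded.\<close>

lemma self_similar_exists:
  assumes N: "N \<ge> 2" and B: "finite B" "B \<noteq> {}"
  shows "\<exists>\<mu> R. is_self_similar N B \<mu> \<and> (AE x in \<mu>. \<bar>x\<bar> \<le> R)"
proof -
  define P where "P = measure_pmf (pmf_of_set B)"
  interpret P: prob_space P unfolding P_def by (rule measure_pmf.prob_space_axioms)
  define S where "S = stream_space P"
  interpret S: prob_space S unfolding S_def by (rule P.prob_space_stream_space)
  \<comment> \<open>The value 0 outside \<open>B\<close> keeps the digits bounded on every stream,
    so the series converges everywhere and not just almost everywhere.\<close>
  define d where "d b = (if b \<in> B then real_of_int b else 0)" for b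
  define K where "K = (\<Sum>b\<in>B. \<bar>real_of_int b\<bar>)"
  have d_le: "\<bar>d b\<bar> \<le> K" for b
    unfolding d_def K_def using B member_le_sum[of b B "\<lambda>b. \<bar>real_of_int b\<bar>"]
    by (auto intro: sum_nonneg)
  define X where "X s = (\<Sum>i. d (s !! i) * (1 / of_int N) ^ Suc i)" for s
  define g where "g = (\<lambda>i. K * (1 / real_of_int N) ^ Suc i)"
  have g: "summable g" unfolding g_def using N
    by (simp del: power_Suc add: summable_Suc_iff)
  have term_le: "norm (d (s !! i) * (1 / of_int N) ^ Suc i) \<le> g i" for s i
    unfolding g_def using order_trans[OF abs_ge_zero d_le] d_le N by (simp only: real_norm_def abs_mult power_abs, intro mult_mono) auto
  have summ: "summable (\<lambda>i. d (s !! i) * (1 / of_int N) ^ Suc i)" for s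
    by (rule summable_comparison_test'[OF g, of 0]) (rule term_le)
  have X_bound: "\<bar>X s\<bar> \<le> suminf g" for s
  proof -
    have "norm (suminf (\<lambda>i. d (s !! i) * (1 / of_int N) ^ Suc i)) \<le> suminf g"
      by (rule order_trans[OF summable_norm suminf_le])
         (use term_le g in \<open>auto intro: summable_comparison_test'[OF g] simp del: power_Suc\<close>)
    then show ?thesis by (simp add: X_def)
  qed
  have X_Stream: "X (b ## s) = (d b + X s) / of_int N" for b s
  proof -
    have "X (b ## s) = d b / of_int N + (\<Sum>i. d (s !! i) * (1 / of_int N) ^ Suc (Suc i))"
      unfolding X_def using suminf_split_head[OF summ[of "b ## s"]] by simp
    also have "(\<Sum>i. d (s !! i) * (1 / of_int N) ^ Suc (Suc i)) = X s / of_int N"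
      unfolding X_def using suminf_divide[OF summ[of s], of "of_int N"] by (simp add: field_simps)
    finally show ?thesis by (simp add: add_divide_distrib)
  qed
  have [measurable]: "(\<lambda>s. s !! i) \<in> measurable S (count_space UNIV)" for i
    using measurable_snth[of i P] by (simp add: S_def P_def)
  have X_meas [measurable]: "X \<in> borel_measurable S"
    unfolding X_def[abs_def] by measurable
  define \<mu> where "\<mu> = distr S borel X"
  have "prob_space \<mu>" unfolding \<mu>_def by (rule S.prob_space_distr) simp
  then interpret M: prob_space \<mu> .
  have [measurable]: "ifs_map N b \<in> borel_measurable borel" for b
    unfolding ifs_map_def[abs_def] by measurable
  have "measure \<mu> A = 1 / real (card B) * (\<Sum>b\<in>B. measure \<mu> (ifs_map N b -` A))"
    if A [measurable]: "A \<in> sets borel" for A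
  proof -
    have "emeasure \<mu> A = emeasure S (X -` A \<inter> space S)"
      unfolding \<mu>_def by (subst emeasure_distr) auto
    also have "\<dots> = (\<integral>\<^sup>+b. emeasure S {s \<in> space S. b ## s \<in> X -` A \<inter> space S} \<partial>P)"
      unfolding S_def by (rule P.emeasure_stream_space) (simp flip: S_def)
    also have "\<dots> = (\<integral>\<^sup>+b. emeasure \<mu> (ifs_map N b -` A) \<partial>P)"
    proof (rule nn_integral_cong_AE)
      have "emeasure S {s \<in> space S. b ## s \<in> X -` A \<inter> space S} = emeasure \<mu> (ifs_map N b -` A)"
        if b: "b \<in> B" for b
      proof -
        have V: "ifs_map N b -` A \<in> sets borel"
          using measurable_sets[of "ifs_map N b" borel borel A] by simp
        have "{s \<in> space S. b ## s \<in> X -` A \<inter> space S} = X -` (ifs_map N b -` A) \<inter> space S"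
          using b by (auto simp: X_Stream ifs_map_def d_def add.commute S_def P_def space_stream_space)
        then show ?thesis unfolding \<mu>_def using V by (subst emeasure_distr) auto
      qed
      then show "AE b in P. emeasure S {s \<in> space S. b ## s \<in> X -` A \<inter> space S} = emeasure \<mu> (ifs_map N b -` A)"
        unfolding P_def using B by (simp add: AE_measure_pmf_iff)
    qed
    also have "\<dots> = ennreal (1 / real (card B) * (\<Sum>b\<in>B. measure \<mu> (ifs_map N b -` A)))"
      unfolding P_def using B
      by (simp add: nn_integral_pmf_of_set M.emeasure_eq_measure sum_ennreal
          divide_ennreal sum_nonneg card_gt_0_iff ennreal_of_nat_eq_real_of_nat)
    finally show ?thesis by (simp add: M.emeasure_eq_measure sum_nonneg)
  qed
  then have "is_self_similar N B \<mu>"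
    using M.prob_space_axioms by (simp add: is_self_similar_def borel_prob_def \<mu>_def)
  moreover have "AE x in \<mu>. \<bar>x\<bar> \<le> suminf g"
    unfolding \<mu>_def using X_bound by (subst AE_distr_iff) auto
  ultimately show ?thesis by blast
qed

lemma self_similar_measure:
  assumes N: "N \<ge> 2" and B: "finite B" "B \<noteq> {}"
  shows "is_self_similar N B (self_similar_measure N B)"
    and "\<exists>R. AE x in self_similar_measure N B. \<bar>x\<bar> \<le> R"
proof -
  obtain \<mu> R where \<mu>: "is_self_similar N B \<mu>" "AE x in \<mu>. \<bar>x\<bar> \<le> R"
    using self_similar_exists[OF assms] by blast
  have "self_similar_measure N B = \<mu>"
    unfolding self_similar_measure_def using \<mu>(1) self_similar_unique[OF assms] by blast
  then show "is_self_similar N B (self_similar_measure N B)"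
    and "\<exists>R. AE x in self_similar_measure N B. \<bar>x\<bar> \<le> R"
    using \<mu> by auto
qed

section \<open>Density of trigonometric polynomials\<close>

lemma cmod_add_square_le: "(cmod (a + b))\<^sup>2 \<le> 2 * (cmod a)\<^sup>2 + 2 * (cmod b)\<^sup>2"
proof -
  have "(cmod (a + b))\<^sup>2 \<le> (cmod a + cmod b)\<^sup>2"
    by (intro power_mono norm_triangle_ineq) simp
  also have "\<dots> \<le> 2 * (cmod a)\<^sup>2 + 2 * (cmod b)\<^sup>2"
    using sum_squares_bound[of "cmod a" "cmod b"] by (simp add: power2_sum)
  finally show ?thesis .
qed

lemma square_integrable_add:
  assumes "square_integrable M f" "square_integrable M g"
  shows "square_integrable M (\<lambda>x. f x + g x)"
  unfolding square_integrable_def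
proof
  show [measurable]: "(\<lambda>x. f x + g x) \<in> borel_measurable M"
    using assms by (auto simp: square_integrable_def)
  have "integrable M (\<lambda>x. 2 * (cmod (f x))\<^sup>2 + 2 * (cmod (g x))\<^sup>2)"
    using assms by (auto simp: square_integrable_def)
  then show "integrable M (\<lambda>x. (cmod (f x + g x))\<^sup>2)"
    by (rule Bochner_Integration.integrable_bound) (use cmod_add_square_le in auto)
qed

lemma square_integrable_scale:
  "square_integrable M f \<Longrightarrow> square_integrable M (\<lambda>x. c * f x)"
  by (auto simp: square_integrable_def norm_mult power_mult_distrib)

lemma square_integrable_diff:
  assumes "square_integrable M f" "square_integrable M g"
  shows "square_integrable M (\<lambda>x. f x - g x)"
  using square_integrable_add[OF assms(1) square_integrable_scale[OF assms(2), of "-1"]] by simp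

locale L2_subspace = real_distribution \<mu> for \<mu> :: "real measure" +
  fixes V :: "(real \<Rightarrow> complex) set"
  assumes V_square_integrable: "v \<in> V \<Longrightarrow> square_integrable \<mu> v"
    and V_zero: "(\<lambda>_. 0) \<in> V"
    and V_add: "v \<in> V \<Longrightarrow> w \<in> V \<Longrightarrow> (\<lambda>x. v x + w x) \<in> V"
    and V_scale: "v \<in> V \<Longrightarrow> (\<lambda>x. c * v x) \<in> V"
begin

text \<open>The closure of \<open>V\<close> in the L2 seminorm; squared distances avoid square
  roots, at the price of a factor 2 in the triangle inequality.\<close>

definition cl :: "(real \<Rightarrow> complex) set" where
  "cl = {f. square_integrable \<mu> f \<and> (\<forall>\<epsilon>>0. \<exists>v\<in>V. (LINT x|\<mu>. (cmod (f x - v x))\<^sup>2) < \<epsilon>)}"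

lemma cl_square_integrable: "f \<in> cl \<Longrightarrow> square_integrable \<mu> f"
  by (simp add: cl_def)

lemma V_subset_cl: "V \<subseteq> cl"
  by (auto simp: cl_def V_square_integrable intro!: bexI)

lemma L2_dist_triangle:
  assumes "square_integrable \<mu> f" "square_integrable \<mu> g"
  shows "(LINT x|\<mu>. (cmod (f x + g x))\<^sup>2) \<le> 2 * (LINT x|\<mu>. (cmod (f x))\<^sup>2) + 2 * (LINT x|\<mu>. (cmod (g x))\<^sup>2)"
proof -
  have "(LINT x|\<mu>. (cmod (f x + g x))\<^sup>2) \<le> (LINT x|\<mu>. 2 * (cmod (f x))\<^sup>2 + 2 * (cmod (g x))\<^sup>2)"
    using assms square_integrable_add[OF assms] cmod_add_square_le
    by (intro integral_mono) (auto simp: square_integrable_def)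
  also have "\<dots> = 2 * (LINT x|\<mu>. (cmod (f x))\<^sup>2) + 2 * (LINT x|\<mu>. (cmod (g x))\<^sup>2)"
    using assms by (simp add: square_integrable_def)
  finally show ?thesis .
qed

text \<open>A closure is closed: two errors below a quarter of the tolerance add up, with the factor
  2 of \<open>L2_dist_triangle\<close>, to less than the whole.\<close>

lemma cl_closed:
  assumes f: "square_integrable \<mu> f"
    and approx: "\<And>\<epsilon>. \<epsilon> > 0 \<Longrightarrow> \<exists>g\<in>cl. (LINT x|\<mu>. (cmod (f x - g x))\<^sup>2) < \<epsilon>"
  shows "f \<in> cl"
proof -
  have "\<exists>v\<in>V. (LINT x|\<mu>. (cmod (f x - v x))\<^sup>2) < \<epsilon>" if \<epsilon>: "\<epsilon> > 0" for \<epsilon>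
  proof -
    obtain g where g: "g \<in> cl" "(LINT x|\<mu>. (cmod (f x - g x))\<^sup>2) < \<epsilon> / 4"
      using approx[of "\<epsilon> / 4"] \<epsilon> by auto
    obtain v where v: "v \<in> V" "(LINT x|\<mu>. (cmod (g x - v x))\<^sup>2) < \<epsilon> / 4"
      using g(1) \<epsilon> by (force simp: cl_def dest: spec[of _ "\<epsilon> / 4"])
    have "(LINT x|\<mu>. (cmod ((f x - g x) + (g x - v x)))\<^sup>2) < \<epsilon>"
      using L2_dist_triangle[of "\<lambda>x. f x - g x" "\<lambda>x. g x - v x"]
        square_integrable_diff[OF f cl_square_integrable[OF g(1)]]
        square_integrable_diff[OF cl_square_integrable[OF g(1)] V_square_integrable[OF v(1)]] g(2) v(2)
      by argo
    then show ?thesis using v(1) by auto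
  qed
  then show ?thesis using f by (simp add: cl_def)
qed

lemma cl_add:
  assumes f: "f \<in> cl" and g: "g \<in> cl"
  shows "(\<lambda>x. f x + g x) \<in> cl"
proof (rule cl_closed)
  show "square_integrable \<mu> (\<lambda>x. f x + g x)"
    using assms cl_square_integrable square_integrable_add by blast
  fix \<epsilon> :: real assume "\<epsilon> > 0"
  then obtain v w where v: "v \<in> V" "(LINT x|\<mu>. (cmod (f x - v x))\<^sup>2) < \<epsilon> / 4"
    and w: "w \<in> V" "(LINT x|\<mu>. (cmod (g x - w x))\<^sup>2) < \<epsilon> / 4"
    using f g by (force simp: cl_def dest: spec[of _ "\<epsilon> / 4"])
  have "(LINT x|\<mu>. (cmod ((f x - v x) + (g x - w x)))\<^sup>2) < \<epsilon>"
    using L2_dist_triangle[of "\<lambda>x. f x - v x" "\<lambda>x. g x - w x"]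
        square_integrable_diff[OF cl_square_integrable[OF f] V_square_integrable[OF v(1)]]
        square_integrable_diff[OF cl_square_integrable[OF g] V_square_integrable[OF w(1)]] v(2) w(2)
      by argo
  then have "(LINT x|\<mu>. (cmod (f x + g x - (v x + w x)))\<^sup>2) < \<epsilon>"
    by (simp add: algebra_simps)
  then show "\<exists>h\<in>cl. (LINT x|\<mu>. (cmod (f x + g x - h x))\<^sup>2) < \<epsilon>"
    using V_add[OF v(1) w(1)] V_subset_cl by (intro bexI[of _ "\<lambda>x. v x + w x"]) auto
qed

lemma cl_scale:
  assumes f: "f \<in> cl"
  shows "(\<lambda>x. c * f x) \<in> cl"
proof (rule cl_closed)
  show "square_integrable \<mu> (\<lambda>x. c * f x)"
    using f cl_square_integrable square_integrable_scale by blast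
  fix \<epsilon> :: real assume \<epsilon>: "\<epsilon> > 0"
  \<comment> \<open>Adding 1 keeps the divisor positive when \<open>c\<close> is 0.\<close>
  let ?k = "(cmod c)\<^sup>2 + 1"
  have k: "?k > 0" by (intro add_nonneg_pos) auto
  obtain v where v: "v \<in> V" "(LINT x|\<mu>. (cmod (f x - v x))\<^sup>2) < \<epsilon> / ?k"
    using f \<epsilon> k by (force simp: cl_def dest: spec[of _ "\<epsilon> / ?k"])
  have "(LINT x|\<mu>. (cmod (c * f x - c * v x))\<^sup>2) = (cmod c)\<^sup>2 * (LINT x|\<mu>. (cmod (f x - v x))\<^sup>2)"
    by (simp add: norm_mult power_mult_distrib flip: right_diff_distrib)
  also have "\<dots> \<le> ?k * (LINT x|\<mu>. (cmod (f x - v x))\<^sup>2)"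
    by (intro mult_right_mono) auto
  also have "\<dots> < \<epsilon>" using v(2) k by (simp add: pos_less_divide_eq mult.commute)
  finally show "\<exists>g\<in>cl. (LINT x|\<mu>. (cmod (c * f x - g x))\<^sup>2) < \<epsilon>"
    using V_scale[OF v(1)] V_subset_cl by (intro bexI[of _ "\<lambda>x. c * v x"]) auto
qed

lemma cl_sum:
  "finite I \<Longrightarrow> (\<And>i. i \<in> I \<Longrightarrow> f i \<in> cl) \<Longrightarrow> (\<lambda>x. \<Sum>i\<in>I. f i x) \<in> cl"
  by (induction I rule: finite_induct) (use V_zero V_subset_cl cl_add in auto)

text \<open>Dominated convergence: the squared distances are bounded by the integrable function
  \<open>4 * (w x)\<^sup>2\<close>, so pointwise convergence becomes convergence in L2.\<close>

lemma cl_dominated_limit: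
  fixes s :: "nat \<Rightarrow> real \<Rightarrow> complex" and w :: "real \<Rightarrow> real"
  assumes s: "\<And>n. s n \<in> cl" and lim: "\<And>x. (\<lambda>n. s n x) \<longlonglongrightarrow> f x"
    and bound: "\<And>n x. cmod (s n x) \<le> w x"
    and w: "w \<in> borel_measurable \<mu>" "integrable \<mu> (\<lambda>x. (w x)\<^sup>2)"
  shows "f \<in> cl"
proof (rule cl_closed)
  have s_meas [measurable]: "s n \<in> borel_measurable \<mu>" for n
    using cl_square_integrable[OF s] by (simp add: square_integrable_def)
  have f_meas [measurable]: "f \<in> borel_measurable \<mu>"
    by (rule borel_measurable_LIMSEQ_metric[OF s_meas lim])
  have f_bound: "cmod (f x) \<le> w x" for x
    by (rule LIMSEQ_le_const2[OF tendsto_norm[OF lim]]) (use bound in auto)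
  have w_nonneg: "0 \<le> w x" for x using order_trans[OF norm_ge_zero f_bound] .
  show "square_integrable \<mu> f"
    unfolding square_integrable_def
  proof
    show "integrable \<mu> (\<lambda>x. (cmod (f x))\<^sup>2)"
      by (rule Bochner_Integration.integrable_bound[OF w(2)])
        (use f_bound in \<open>auto intro!: power_mono\<close>)
  qed simp
  have "(\<lambda>n. LINT x|\<mu>. (cmod (f x - s n x))\<^sup>2) \<longlonglongrightarrow> (LINT x|\<mu>. 0)"
  proof (rule integral_dominated_convergence[where w = "\<lambda>x. 4 * (w x)\<^sup>2"])
    show "AE x in \<mu>. (\<lambda>n. (cmod (f x - s n x))\<^sup>2) \<longlonglongrightarrow> 0"
    proof (rule AE_I2)
      fix x
      have "(\<lambda>n. (cmod (f x - s n x))\<^sup>2) \<longlonglongrightarrow> (cmod (f x - f x))\<^sup>2"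
        by (intro tendsto_intros lim)
      then show "(\<lambda>n. (cmod (f x - s n x))\<^sup>2) \<longlonglongrightarrow> 0" by simp
    qed
    fix n
    have "(cmod (f x - s n x))\<^sup>2 \<le> 4 * (w x)\<^sup>2" for x
    proof -
      have "cmod (f x - s n x) \<le> 2 * w x"
        using norm_triangle_ineq4[of "f x" "s n x"] f_bound[of x] bound[of n x] by simp
      then have "(cmod (f x - s n x))\<^sup>2 \<le> (2 * w x)\<^sup>2" by (intro power_mono) auto
      then show ?thesis by (simp add: power_mult_distrib)
    qed
    then show "AE x in \<mu>. norm ((cmod (f x - s n x))\<^sup>2) \<le> 4 * (w x)\<^sup>2" by simp
  qed (use w in auto)
  then have lim0: "(\<lambda>n. LINT x|\<mu>. (cmod (f x - s n x))\<^sup>2) \<longlonglongrightarrow> 0" by simp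
  fix \<epsilon> :: real assume "\<epsilon> > 0"
  then have "eventually (\<lambda>n. (LINT x|\<mu>. (cmod (f x - s n x))\<^sup>2) < \<epsilon>) sequentially"
    by (rule order_tendstoD(2)[OF lim0])
  then show "\<exists>g\<in>cl. (LINT x|\<mu>. (cmod (f x - g x))\<^sup>2) < \<epsilon>"
    using s by (auto simp: eventually_sequentially)
qed

end

section \<open>Trigonometric polynomials with arbitrary real frequencies\<close>

inductive trig_poly :: "(real \<Rightarrow> complex) \<Rightarrow> bool" where
  expo: "trig_poly (expo \<xi>)"
| add: "trig_poly f \<Longrightarrow> trig_poly g \<Longrightarrow> trig_poly (\<lambda>x. f x + g x)"
| scale: "trig_poly f \<Longrightarrow> trig_poly (\<lambda>x. c * f x)"

lemma trig_poly_continuous: "trig_poly f \<Longrightarrow> continuous_on S f"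
  by (induction rule: trig_poly.induct) (auto intro!: continuous_intros)

lemma trig_poly_mult:
  assumes "trig_poly f" "trig_poly g"
  shows "trig_poly (\<lambda>x. f x * g x)"
  using assms
proof (induction f rule: trig_poly.induct)
  case (expo \<xi>)
  then show ?case
  proof (induction g rule: trig_poly.induct)
    case (expo \<eta>)
    then show ?case using trig_poly.expo[of "\<xi> + \<eta>"] by (simp add: expo_add[abs_def])
  next
    case (add f g)
    then show ?case using trig_poly.add by (fastforce simp: distrib_left)
  next
    case (scale f c)
    then show ?case using trig_poly.scale[of _ c] by (fastforce simp: mult.left_commute)
  qed
next
  case (add f g)
  then show ?case using trig_poly.add by (fastforce simp: distrib_right)
next
  case (scale f c)
  then show ?case using trig_poly.scale[of _ c] by (fastforce simp: mult.assoc)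
qed

text \<open>Stone-Weierstrass for the algebra of real functions that are trigonometric polynomials.
  As no period is fixed, sines of low frequency separate any two points of the interval.\<close>

lemma trig_poly_approximates:
  fixes f :: "real \<Rightarrow> real"
  assumes "continuous_on {-R..R} f" "\<epsilon> > 0"
  shows "\<exists>g. trig_poly (\<lambda>x. complex_of_real (g x)) \<and> (\<forall>x\<in>{-R..R}. \<bar>f x - g x\<bar> < \<epsilon>)"
proof (rule Stone_Weierstrass_HOL[OF compact_Icc _ _ _ _ _ assms])
  show "trig_poly (\<lambda>x. complex_of_real c)" for c
    using trig_poly.scale[OF trig_poly.expo[of 0], of "complex_of_real c"] by simp
  show "continuous_on {-R..R} g" if "trig_poly (\<lambda>x. complex_of_real (g x))" for g
    using continuous_on_Re[OF trig_poly_continuous[OF that]] by simp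
  show "trig_poly (\<lambda>x. complex_of_real (g x + h x))"
    if "trig_poly (\<lambda>x. complex_of_real (g x)) \<and> trig_poly (\<lambda>x. complex_of_real (h x))" for g h
    using that trig_poly.add by fastforce
  show "trig_poly (\<lambda>x. complex_of_real (g x * h x))"
    if "trig_poly (\<lambda>x. complex_of_real (g x)) \<and> trig_poly (\<lambda>x. complex_of_real (h x))" for g h
    using that trig_poly_mult by fastforce
  show "\<exists>g. trig_poly (\<lambda>x. complex_of_real (g x)) \<and> g x \<noteq> g y"
    if "x \<in> {-R..R} \<and> y \<in> {-R..R} \<and> x \<noteq> y" for x y
  proof -
    \<comment> \<open>A quarter period equals y - x, so the sine below is 0 at \<open>x\<close> and
      1 at \<open>y\<close>.\<close>
    define \<xi> where "\<xi> = 1 / (4 * (y - x))"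
    define g where "g t = sin (2 * pi * \<xi> * (t - x))" for t
    have "complex_of_real (g t) = (expo \<xi> (- x) / (2 * \<i>)) * expo \<xi> t + (- expo (- \<xi>) (- x) / (2 * \<i>)) * expo (- \<xi>) t" for t
    proof -
      have "complex_of_real (g t) = (expo \<xi> (t - x) - cnj (expo \<xi> (t - x))) / (2 * \<i>)"
        by (simp add: g_def expo_eq_cis complex_eq_iff)
      also have "\<dots> = (expo \<xi> (t + (- x)) - expo (- \<xi>) (t + (- x))) / (2 * \<i>)"
        by (simp add: cnj_expo)
      finally show ?thesis unfolding expo_add_right by (simp add: field_simps)
    qed
    then have "trig_poly (\<lambda>t. complex_of_real (g t))"
      by (simp only:) (intro trig_poly.intros)
    moreover have "2 * pi * \<xi> * (y - x) = pi / 2" using that by (simp add: \<xi>_def field_simps)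
    then have "g y = 1" unfolding g_def by (simp only: sin_pi_half)
    then have "g x \<noteq> g y" by (simp add: g_def)
    ultimately show ?thesis by blast
  qed
qed

section \<open>From exponentials to all of L2\<close>

context L2_subspace
begin

lemma square_integrable_bounded:
  assumes "f \<in> borel_measurable borel" "\<And>x. cmod (f x) \<le> K"
  shows "square_integrable \<mu> f"
  unfolding square_integrable_def
proof
  show "f \<in> borel_measurable \<mu>" using assms(1) by simp
  then show "integrable \<mu> (\<lambda>x. (cmod (f x))\<^sup>2)"
    using assms(2) by (intro integrable_const_bound[of _ "K\<^sup>2"]) (auto intro!: power_mono)
qed

lemma trig_poly_square_integrable: "trig_poly f \<Longrightarrow> square_integrable \<mu> f"
  by (induction rule: trig_poly.induct)
     (auto intro: square_integrable_add square_integrable_scale square_integrable_bounded[of _ 1])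

text \<open>The closure absorbs ever larger classes: trigonometric polynomials, bounded continuous
  functions (by uniform approximation on the bounded support), indicators of half-lines, indicators
  of Borel sets, simple functions, and finally all square integrable functions.\<close>

lemma dense_cl:
  assumes supp: "AE x in \<mu>. \<bar>x\<bar> \<le> R"
    and expo: "\<And>\<xi>. expo \<xi> \<in> cl" and f: "square_integrable \<mu> f"
  shows "f \<in> cl"
proof -
  have trig: "g \<in> cl" if "trig_poly g" for g
    using that by (induction rule: trig_poly.induct) (auto intro: expo cl_add cl_scale)
  have cont: "(\<lambda>x. complex_of_real (g x)) \<in> cl"
    if g: "continuous_on UNIV g" "\<And>x. \<bar>g x\<bar> \<le> 1" for g :: "real \<Rightarrow> real"
  proof (rule cl_closed)
    have [measurable]: "g \<in> borel_measurable borel"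
      using g(1) by (rule borel_measurable_continuous_onI)
    show si: "square_integrable \<mu> (\<lambda>x. complex_of_real (g x))"
      by (rule square_integrable_bounded[of _ 1]) (use g in auto)
    fix \<epsilon> :: real assume \<epsilon>: "\<epsilon> > 0"
    \<comment> \<open>The minimum with 1 gives \<delta> squared \<le> \<delta>, hence less than the
      tolerance.\<close>
    define \<delta> where "\<delta> = min 1 (\<epsilon> / 2)"
    have \<delta>: "\<delta> > 0" "\<delta>\<^sup>2 < \<epsilon>"
    proof -
      show "\<delta> > 0" using \<epsilon> by (simp add: \<delta>_def)
      then have "\<delta>\<^sup>2 \<le> \<delta> * 1" unfolding power2_eq_square by (intro mult_left_mono) (auto simp: \<delta>_def)
      then show "\<delta>\<^sup>2 < \<epsilon>" using \<epsilon> by (simp add: \<delta>_def)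
    qed
    obtain h where h: "trig_poly (\<lambda>x. complex_of_real (h x))" "\<forall>x\<in>{-R..R}. \<bar>g x - h x\<bar> < \<delta>"
      using trig_poly_approximates[OF continuous_on_subset[OF g(1)] \<delta>(1)] by auto
    have "(LINT x|\<mu>. (cmod (complex_of_real (g x) - complex_of_real (h x)))\<^sup>2) \<le> (LINT x|\<mu>. \<delta>\<^sup>2)"
    proof (rule integral_mono_AE)
      show "integrable \<mu> (\<lambda>x. (cmod (complex_of_real (g x) - complex_of_real (h x)))\<^sup>2)"
        using square_integrable_diff[OF si trig_poly_square_integrable[OF h(1)]]
        by (simp add: square_integrable_def)
      show "AE x in \<mu>. (cmod (complex_of_real (g x) - complex_of_real (h x)))\<^sup>2 \<le> \<delta>\<^sup>2"
        using supp
      proof eventually_elim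
        case (elim x)
        then have "x \<in> {-R..R}" by auto
        then have "\<bar>g x - h x\<bar> \<le> \<delta>" using h(2) by (intro less_imp_le) blast
        then show ?case by (simp add: power2_le_iff_abs_le flip: of_real_diff)
      qed
    qed simp
    also have "\<dots> < \<epsilon>" using \<delta> prob_space by simp
    finally show "\<exists>h\<in>cl. (LINT x|\<mu>. (cmod (complex_of_real (g x) - h x))\<^sup>2) < \<epsilon>"
      using trig[OF h(1)] by (intro bexI[of _ "\<lambda>x. complex_of_real (h x)"])
  qed
  have "expo 0 = (\<lambda>_. 1)" by auto
  then have one: "(\<lambda>_. 1) \<in> cl" using expo[of 0] by simp
  \<comment> \<open>Continuous ramps of slope -n, starting to fall at \<open>a\<close>, converge
    pointwise to the indicator.\<close>
  have half: "(\<lambda>x. indicator {..a} x) \<in> cl" for a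
  proof (rule cl_dominated_limit[where w = "\<lambda>_. 1"])
    fix n
    show "(\<lambda>x. complex_of_real (max 0 (min 1 (1 - real n * (x - a))))) \<in> cl"
      by (rule cont) (auto intro!: continuous_intros)
  next
    fix x
    show "(\<lambda>n. complex_of_real (max 0 (min 1 (1 - real n * (x - a))))) \<longlonglongrightarrow> indicator {..a} x"
    proof (cases "x \<le> a")
      case True
      then have "real n * (x - a) \<le> 0" for n by (simp add: mult_nonneg_nonpos)
      then have "max 0 (min 1 (1 - real n * (x - a))) = 1" for n
        by (smt (verit))
      then show ?thesis using True by simp
    next
      case False
      obtain m :: nat where m: "1 / (x - a) < real m" using reals_Archimedean2 by blast
      have "max 0 (min 1 (1 - real n * (x - a))) = 0" if "n \<ge> m" for n
      proof -
        have "1 / (x - a) < real n" using m that by (meson less_le_trans of_nat_mono)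
        then have "1 < real n * (x - a)" using False by (simp add: field_simps)
        then show ?thesis by simp
      qed
      then have "eventually (\<lambda>n. complex_of_real (max 0 (min 1 (1 - real n * (x - a)))) = 0) sequentially"
        unfolding eventually_sequentially by (intro exI[of _ m]) auto
      then show ?thesis using False by (simp add: tendsto_eventually)
    qed
  qed auto
  \<comment> \<open>Half-lines are stable under intersection and generate the Borel sets;
    complements and disjoint unions stay in the closure, so Dynkin's theorem applies.\<close>
  have ind: "(\<lambda>x. indicator A x) \<in> cl" if "A \<in> sets borel" for A :: "real set"
  proof -
    have "Int_stable (range (atMost :: real \<Rightarrow> real set))"
      by (auto simp: Int_stable_def)
    moreover have "range (atMost :: real \<Rightarrow> real set) \<subseteq> Pow UNIV" by simp
    moreover have "A \<in> sigma_sets UNIV (range atMost)"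
      using that by (simp add: borel_eq_atMost)
    ultimately show ?thesis
    proof (induction rule: sigma_sets_induct_disjoint)
      case (basic A)
      then show ?case using half by auto
    next
      case empty
      then show ?case using V_zero V_subset_cl by auto
    next
      case (compl A)
      have "(\<lambda>x. 1 + (- 1) * indicator A x :: complex) \<in> cl"
        by (intro cl_add cl_scale one compl)
      moreover have "(\<lambda>x. 1 + (- 1) * indicator A x :: complex) = (\<lambda>x. indicator (UNIV - A) x)"
        by (auto simp: indicator_def)
      ultimately show ?case by simp
    next
      case (union A)
      show ?case
      proof (rule cl_dominated_limit[where w = "\<lambda>_. 1"])
        fix n
        show "(\<lambda>x. \<Sum>i<n. indicator (A i) x :: complex) \<in> cl"
          by (intro cl_sum union) auto
        have *: "(\<Sum>i<n. indicator (A i) x :: complex) = indicator (\<Union>i<n. A i) x" for x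
          by (subst indicator_UN_disjoint)
            (use union(1) in \<open>auto simp: disjoint_family_on_def\<close>)
        show "cmod (\<Sum>i<n. indicator (A i) x :: complex) \<le> 1" for x
          unfolding * by (auto simp: indicator_def)
      next
        fix x
        have "(\<lambda>i. indicator (A i) x :: real) sums indicator (\<Union>i. A i) x"
          by (rule indicator_sums) (use union(1) in \<open>auto simp: disjoint_family_on_def\<close>)
        then have "(\<lambda>i. complex_of_real (indicator (A i) x)) sums complex_of_real (indicator (\<Union>i. A i) x)"
          by (rule sums_of_real)
        then have "(\<lambda>i. indicator (A i) x :: complex) sums indicator (\<Union>i. A i) x"
          by (simp only: of_real_indicator)
        then show "(\<lambda>n. \<Sum>i<n. indicator (A i) x :: complex) \<longlonglongrightarrow> indicator (\<Union>i. A i) x"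
          by (simp add: sums_def)
      qed auto
    qed
  qed
  have simple: "g \<in> cl" if g: "simple_function \<mu> g" for g
  proof -
    have "(\<lambda>x. \<Sum>y\<in>range g. y * indicator (g -` {y}) x) \<in> cl"
    proof (rule cl_sum)
      show "finite (range g)" using simple_functionD(1)[OF g] by simp
      fix y
      have "g -` {y} \<in> sets borel" using simple_functionD(2)[OF g, of "{y}"] by simp
      then show "(\<lambda>x. y * indicator (g -` {y}) x) \<in> cl" by (intro cl_scale ind)
    qed
    moreover have "(\<Sum>y\<in>range g. y * indicator (g -` {y}) x) = g x" for x
    proof -
      have "(\<Sum>y\<in>range g. y * indicator (g -` {y}) x) = (\<Sum>y\<in>{g x}. y * indicator (g -` {y}) x)"
        using simple_functionD(1)[OF g] by (intro sum.mono_neutral_right) auto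
      then show ?thesis by simp
    qed
    ultimately show ?thesis by simp
  qed
  have f_meas [measurable]: "f \<in> borel_measurable \<mu>" using f by (simp add: square_integrable_def)
  obtain F where F: "\<And>i. simple_function \<mu> (F i)" "\<And>x. (\<lambda>i. F i x) \<longlonglongrightarrow> f x"
    "\<And>i x. cmod (F i x) \<le> 2 * cmod (f x)"
    using borel_measurable_implies_sequence_metric[OF f_meas, of 0] by auto
  show ?thesis
    by (rule cl_dominated_limit[OF simple[OF F(1)] F(2,3)])
      (use f in \<open>auto simp: square_integrable_def power_mult_distrib\<close>)
qed

end

section \<open>Spectra from Hadamard triples without cycles\<close>

text \<open>Bezout, one element at a time. With \<open>Gcd B = 1\<close> it turns integrality of all
  products b * y into integrality of y.\<close>

lemma Gcd_mult_in_Ints: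
  assumes "finite B" "\<And>b. b \<in> B \<Longrightarrow> real_of_int b * y \<in> \<int>"
  shows "real_of_int (Gcd B) * y \<in> \<int>"
  using assms
proof (induction B rule: finite_induct)
  case (insert a B)
  obtain u v where uv: "u * a + v * Gcd B = gcd a (Gcd B)" using bezout_int by blast
  have "real_of_int (gcd a (Gcd B)) * y = of_int u * (of_int a * y) + of_int v * (of_int (Gcd B) * y)"
    by (simp add: algebra_simps flip: uv)
  moreover have "of_int a * y \<in> \<int>" "of_int (Gcd B) * y \<in> \<int>" using insert by auto
  ultimately have "real_of_int (gcd a (Gcd B)) * y \<in> \<int>"
    by (simp add: Ints_add Ints_mult[OF Ints_of_int])
  then show ?case by simp
qed simp

text \<open>The equality case of the triangle inequality: an average of unit numbers has modulus 1
  only if they all coincide, and the term for the digit 0 is 1.\<close>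

lemma cmod_mask_eq_1:
  assumes B: "finite B" "0 \<in> B" and m: "cmod (ifs_mask B x) = 1" and b: "b \<in> B"
  shows "expo x (of_int b) = 1"
proof -
  define u where "u = ifs_mask B x"
  have card: "card B > 0" using B by (auto simp: card_gt_0_iff)
  have u: "u * cnj u = 1" using m by (simp add: u_def complex_norm_square[symmetric])
  have sum: "(\<Sum>b\<in>B. expo x (of_int b)) = of_nat (card B) * u"
    using card by (simp add: u_def ifs_mask_def)
  \<comment> \<open>After rotation by \<open>cnj u\<close> the summands are nonnegative and add up
    to 0, so each vanishes.\<close>
  have "(\<Sum>b\<in>B. 1 - Re (expo x (of_int b) * cnj u)) = real (card B) - Re ((\<Sum>b\<in>B. expo x (of_int b)) * cnj u)"
    by (simp add: sum_subtractf sum_distrib_right)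
  also have "\<dots> = 0" unfolding sum using u by (simp add: mult.assoc)
  finally have z: "(\<Sum>b\<in>B. 1 - Re (expo x (of_int b) * cnj u)) = 0" .
  have unit: "cmod (expo x (of_int b) * cnj u) = 1" for b using m by (simp add: norm_mult u_def)
  have eq: "expo x (of_int b) = u" if "b \<in> B" for b
  proof -
    have "Re (expo x (of_int b) * cnj u) \<le> 1" for b
      using complex_Re_le_cmod[of "expo x (of_int b) * cnj u"] unit by simp
    then have re: "Re (expo x (of_int b) * cnj u) = 1"
      using z that sum_nonneg_eq_0_iff[OF B(1), of "\<lambda>b. 1 - Re (expo x (of_int b) * cnj u)"] by force
    moreover from re have "Im (expo x (of_int b) * cnj u) = 0"
      using unit[of b] unfolding cmod_def by simp
    ultimately have "expo x (of_int b) * cnj u = 1" by (intro complex_eqI) simp_all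
    then have "expo x (of_int b) * (u * cnj u) = u" by (simp add: mult.left_commute)
    then show ?thesis using u by simp
  qed
  show ?thesis using eq[OF b] eq[OF B(2)] by simp
qed

text \<open>The last assumption states that distinct rows of the matrix with entries exp(2 pi i b l
  / N) are orthogonal; the matrix is square because of \<open>card_L\<close>.
  \<open>Gcd B = 1\<close> forces points where the mask has modulus 1 to be integers.\<close>

locale hadamard_ifs =
  fixes N :: int and B L :: "int set"
  assumes N: "N \<ge> 2"
    and finite_B: "finite B" and B0: "0 \<in> B" and Gcd_B: "Gcd B = 1"
    and finite_L: "finite L" and L0: "0 \<in> L" and card_L: "card L = card B"
    and hadamard: "b \<in> B \<Longrightarrow> b' \<in> B \<Longrightarrow> b \<noteq> b' \<Longrightarrow>
      (\<Sum>l\<in>L. expo (of_int (b - b')) (of_int l / of_int N)) = 0"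
begin

definition weight :: "real \<Rightarrow> real" where
  "weight x = (cmod (ifs_mask B x))\<^sup>2"

text \<open>These maps act on frequencies and use the digits in \<open>L\<close>; they are dual to
  the maps \<open>ifs_map\<close> on points, which use \<open>B\<close>.\<close>

definition branch :: "int \<Rightarrow> real \<Rightarrow> real" where
  "branch l x = (x + of_int l) / of_int N"

lemma B_ne: "B \<noteq> {}" using B0 by blast

lemma card_B: "card B > 0" using finite_B B_ne by (simp add: card_gt_0_iff)

text \<open>Expanding the square gives a double sum over \<open>B\<close>; summing over
  \<open>L\<close> first kills all terms off the diagonal by the Hadamard condition.\<close>

lemma weight_sum: "(\<Sum>l\<in>L. weight (branch l x)) = 1"
proof -
  have e': "expo y (of_int b) * cnj (expo y (of_int b')) = expo y (of_int (b - b'))" for y b b'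
    by (simp add: expo_eq_cis cis_cnj cis_mult algebra_simps)
  have w: "complex_of_real (weight y) = (\<Sum>b\<in>B. \<Sum>b'\<in>B. expo y (of_int (b - b'))) / (of_nat (card B))\<^sup>2" for y
  proof -
    have "complex_of_real (weight y) = ifs_mask B y * cnj (ifs_mask B y)"
      by (simp add: weight_def complex_norm_square del: of_real_power)
    also have "\<dots> = (\<Sum>b\<in>B. \<Sum>b'\<in>B. expo y (of_int b) * cnj (expo y (of_int b'))) / (of_nat (card B))\<^sup>2"
      by (simp add: ifs_mask_def sum_product power2_eq_square)
    finally show ?thesis by (simp add: e')
  qed
  have e: "expo (branch l x) (of_int (b - b')) = expo (x / of_int N) (of_int (b - b')) * expo (of_int (b - b')) (of_int l / of_int N)" for l b b'
    by (simp add: branch_def add_divide_distrib expo_add expo_commute[of "of_int l / of_int N"])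
  have "complex_of_real (\<Sum>l\<in>L. weight (branch l x)) = (\<Sum>l\<in>L. \<Sum>b\<in>B. \<Sum>b'\<in>B. expo (branch l x) (of_int (b - b'))) / (of_nat (card B))\<^sup>2"
    by (simp add: w sum_divide_distrib)
  also have "(\<Sum>l\<in>L. \<Sum>b\<in>B. \<Sum>b'\<in>B. expo (branch l x) (of_int (b - b'))) = (\<Sum>b\<in>B. \<Sum>b'\<in>B. \<Sum>l\<in>L. expo (branch l x) (of_int (b - b')))"
    by (subst sum.swap) (intro sum.cong refl sum.swap)
  also have "\<dots> = (\<Sum>b\<in>B. \<Sum>b'\<in>B. if b' = b then of_nat (card B) else 0)"
  proof (intro sum.cong refl)
    fix b b' assume b: "b \<in> B" "b' \<in> B"
    have "(\<Sum>l\<in>L. expo (branch l x) (of_int (b - b'))) = expo (x / of_int N) (of_int (b - b')) * (\<Sum>l\<in>L. expo (of_int (b - b')) (of_int l / of_int N))"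
      unfolding e by (simp add: sum_distrib_left)
    then show "(\<Sum>l\<in>L. expo (branch l x) (of_int (b - b'))) = (if b' = b then of_nat (card B) else 0)"
      using hadamard[OF b] by (auto simp: card_L)
  qed
  also have "\<dots> = (of_nat (card B))\<^sup>2"
    using finite_B by (simp add: power2_eq_square)
  finally have "complex_of_real (\<Sum>l\<in>L. weight (branch l x)) = of_real 1" using card_B by simp
  then show ?thesis unfolding of_real_eq_iff .
qed

lemma weight_nonneg: "weight x \<ge> 0" by (simp add: weight_def)

text \<open>Evaluating the weights at \<open>x = - l'\<close>, where the branch \<open>l'\<close> alone already carries weight 1.\<close>

lemma mask_eq_0:
  assumes "l \<in> L" "l' \<in> L" "l \<noteq> l'"
  shows "ifs_mask B (of_int (l - l') / of_int N) = 0"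
proof -
  have "(\<Sum>k\<in>L. weight (branch k (- of_int l'))) = weight (branch l' (- of_int l')) + (\<Sum>k\<in>L - {l'}. weight (branch k (- of_int l')))"
    by (rule sum.remove[OF finite_L assms(2)])
  moreover have "weight (branch l' (- of_int l')) = 1"
    using mask_int[OF finite_B B_ne, of 0] by (simp add: weight_def branch_def)
  ultimately have "(\<Sum>k\<in>L - {l'}. weight (branch k (- of_int l'))) = 0"
    using weight_sum[of "- of_int l'"] by simp
  then have "weight (branch l (- of_int l')) = 0"
    using assms finite_L weight_nonneg by (subst (asm) sum_nonneg_eq_0_iff) auto
  then show ?thesis by (simp add: weight_def branch_def)
qed

text \<open>For distinct digits the mask vanishes at (l - l')/N, whereas it is 1 at every
  integer.\<close>

lemma L_incongruent:
  assumes "l \<in> L" "l' \<in> L" "N dvd l - l'"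
  shows "l = l'"
proof (rule ccontr)
  assume "l \<noteq> l'"
  obtain k where "l - l' = N * k" using assms(3) by blast
  then have "real_of_int (l - l') / of_int N = of_int k" using N by simp
  then show False
    using mask_eq_0[OF assms(1,2) \<open>l \<noteq> l'\<close>] mask_int[OF finite_B B_ne, of "of_int k"] by simp
qed

section \<open>Digit expansions and orthogonality of the exponentials\<close>

primrec Lam :: "nat \<Rightarrow> int set" where
  "Lam 0 = {0}"
| "Lam (Suc n) = (\<lambda>(l, k). l + N * k) ` (L \<times> Lam n)"

lemma finite_Lam: "finite (Lam n)"
  by (induction n) (use finite_L in auto)

lemma digit_unique:
  assumes "l \<in> L" "l' \<in> L" "l + N * k = l' + N * k'"
  shows "l = l'" "k = k'"
proof -
  have "l - l' = N * (k' - k)" using assms(3) by (simp add: algebra_simps)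
  then show "l = l'" using L_incongruent assms(1,2) dvd_triv_left by metis
  then show "k = k'" using assms(3) N by simp
qed

lemma inj_digit: "inj_on (\<lambda>(l, k). l + N * k) (L \<times> A)"
  by (auto simp: inj_on_def dest: digit_unique)

definition \<mu> :: "real measure" where "\<mu> = self_similar_measure N B"

lemma self_similar: "is_self_similar N B \<mu>"
  unfolding \<mu>_def by (rule self_similar_measure(1)[OF N finite_B B_ne])

lemma bounded_support: "\<exists>R. AE x in \<mu>. \<bar>x\<bar> \<le> R"
  unfolding \<mu>_def by (rule self_similar_measure(2)[OF N finite_B B_ne])

sublocale real_distribution \<mu>
  using self_similar by (simp add: is_self_similar_def borel_prob_iff)

lemma borel_prob: "borel_prob \<mu>" using self_similar by (simp add: is_self_similar_def)

lemma fourier_step: "fourier \<mu> x = ifs_mask B (x / of_int N) * fourier \<mu> (x / of_int N)"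
  by (rule fourier_self_similar[OF self_similar finite_B B_ne])

lemma fourier_0: "fourier \<mu> 0 = 1" by (simp add: fourier_eq_char char_zero)

lemma fourier_le_1: "cmod (fourier \<mu> x) \<le> 1" by (simp add: fourier_eq_char cmod_char_le_1)

text \<open>The mask has period 1, so the integer part \<open>k\<close> survives only in the second
  factor. This peels off the lowest digit.\<close>

lemma fourier_branch:
  "fourier \<mu> (x + of_int (l + N * k)) = ifs_mask B (branch l x) * fourier \<mu> (branch l x + of_int k)"
proof -
  have "(x + of_int (l + N * k)) / of_int N = branch l x + of_int k"
    using N by (simp add: branch_def field_simps)
  then show ?thesis using fourier_step[of "x + of_int (l + N * k)"] by (simp add: mask_add_int)
qed

text \<open>At the lowest position where the expansions differ, the product formula contributes a
  mask factor that is 0 by \<open>mask_eq_0\<close>.\<close>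

lemma fourier_orthogonal:
  "s \<in> Lam n \<Longrightarrow> t \<in> Lam n \<Longrightarrow> s \<noteq> t \<Longrightarrow> fourier \<mu> (of_int (s - t)) = 0"
proof (induction n arbitrary: s t)
  case (Suc n)
  obtain l k l' k' where eq: "s = l + N * k" "t = l' + N * k'"
    and in_L: "l \<in> L" "l' \<in> L" and in_Lam: "k \<in> Lam n" "k' \<in> Lam n"
    using Suc.prems by auto
  have "s - t = (l - l') + N * (k - k')" by (simp add: eq algebra_simps)
  then have f: "fourier \<mu> (of_int (s - t)) = ifs_mask B (of_int (l - l') / of_int N) * fourier \<mu> (branch (l - l') 0 + of_int (k - k'))"
    using fourier_branch[of 0 "l - l'" "k - k'"] by (simp add: branch_def)
  show ?case
  proof (cases "l = l'")
    case True
    then have "k \<noteq> k'" using Suc.prems eq by auto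
    then show ?thesis using Suc.IH[OF in_Lam] f True by (simp add: branch_def)
  next
    case False
    then show ?thesis using f mask_eq_0[OF in_L] by simp
  qed
qed simp

section \<open>Squared projection lengths and their limit\<close>

primrec Q :: "nat \<Rightarrow> real \<Rightarrow> real" where
  "Q 0 x = (cmod (fourier \<mu> x))\<^sup>2"
| "Q (Suc n) x = (\<Sum>l\<in>L. weight (branch l x) * Q n (branch l x))"

text \<open>Links the iterated averaging operator with a sum over frequencies. Digit expansions are
  injective, so the sum over \<open>Lam (Suc n)\<close> splits according to the lowest
  digit.\<close>

lemma Q_eq: "Q n x = (\<Sum>k\<in>Lam n. (cmod (fourier \<mu> (x + of_int k)))\<^sup>2)"
proof (induction n arbitrary: x)
  case (Suc n)
  have "(\<Sum>k\<in>Lam (Suc n). (cmod (fourier \<mu> (x + of_int k)))\<^sup>2)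
      = (\<Sum>(l, k)\<in>L \<times> Lam n. (cmod (fourier \<mu> (x + of_int (l + N * k))))\<^sup>2)"
    unfolding Lam.simps by (subst sum.reindex[OF inj_digit]) (simp add: split_beta')
  also have "\<dots> = (\<Sum>l\<in>L. \<Sum>k\<in>Lam n. weight (branch l x) * (cmod (fourier \<mu> (branch l x + of_int k)))\<^sup>2)"
    unfolding fourier_branch
    by (simp add: sum.cartesian_product norm_mult power_mult_distrib weight_def)
  finally show ?case by (simp add: Suc.IH sum_distrib_left)
qed simp

lemma Q_nonneg: "Q n x \<ge> 0"
  by (simp add: Q_eq sum_nonneg)

lemma Q_le_1: "Q n x \<le> 1"
proof (induction n arbitrary: x)
  case 0
  then show ?case using fourier_le_1 by (simp add: power_le_one)
next
  case (Suc n)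
  have "Q (Suc n) x \<le> (\<Sum>l\<in>L. weight (branch l x) * 1)"
    unfolding Q.simps by (intro sum_mono mult_left_mono Suc weight_nonneg)
  then show ?case by (simp add: weight_sum)
qed

text \<open>For n = 0, the term of the digit 0 alone already reproduces the left side; positivity of
  the weights propagates the inequality.\<close>

lemma Q_Suc_ge: "Q n x \<le> Q (Suc n) x"
proof (induction n arbitrary: x)
  case 0
  have "Q 0 x = weight (branch 0 x) * Q 0 (branch 0 x)"
    using fourier_step[of x] by (simp add: norm_mult power_mult_distrib weight_def branch_def)
  also have "\<dots> \<le> (\<Sum>l\<in>L. weight (branch l x) * Q 0 (branch l x))"
    using L0 finite_L by (intro member_le_sum mult_nonneg_nonneg weight_nonneg Q_nonneg)
  finally show ?case by simp
next
  case (Suc n)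
  then show ?case by (auto intro!: sum_mono mult_left_mono weight_nonneg simp del: Q.simps simp add: Q.simps(2))
qed

lemma incseq_Q: "incseq (\<lambda>n. Q n x)" by (intro incseq_SucI Q_Suc_ge)

lemma continuous_Q: "continuous_on S (Q n)"
  unfolding Q_eq
  by (intro continuous_intros continuous_on_compose2[OF continuous_fourier[OF borel_prob, of UNIV]]) auto

definition Qlim :: "real \<Rightarrow> real" where "Qlim x = (SUP n. Q n x)"

lemma bdd_Q: "bdd_above (range (\<lambda>n. Q n x))" using Q_le_1 by (auto intro!: bdd_aboveI)

lemma Q_tendsto: "(\<lambda>n. Q n x) \<longlonglongrightarrow> Qlim x"
  unfolding Qlim_def by (rule LIMSEQ_incseq_SUP[OF bdd_Q incseq_Q])

lemma Q_le_Qlim: "Q n x \<le> Qlim x"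
  unfolding Qlim_def by (rule cSUP_upper[OF _ bdd_Q]) simp

lemma Qlim_le_1: "Qlim x \<le> 1"
  unfolding Qlim_def by (rule cSUP_least) (use Q_le_1 in auto)

lemma Qlim_eq: "Qlim x = (\<Sum>l\<in>L. weight (branch l x) * Qlim (branch l x))"
proof -
  have "(\<lambda>n. Q (Suc n) x) \<longlonglongrightarrow> (\<Sum>l\<in>L. weight (branch l x) * Qlim (branch l x))"
    unfolding Q.simps by (intro tendsto_intros Q_tendsto)
  then show ?thesis using LIMSEQ_Suc[OF Q_tendsto] LIMSEQ_unique by blast
qed

text \<open>A supremum of continuous functions is lower semicontinuous and hence attains its minimum
  on a compact interval. The proof follows a convergent subsequence of a minimizing
  sequence.\<close>

lemma Qlim_attains_min:
  assumes "C \<ge> 0"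
  shows "\<exists>x0\<in>{-C..C}. \<forall>x\<in>{-C..C}. Qlim x0 \<le> Qlim x"
proof -
  define c where "c = (INF x\<in>{-C..C}. Qlim x)"
  have ne: "{-C..C} \<noteq> {}" using assms by simp
  have bdd: "bdd_below (Qlim ` {-C..C})"
    using order_trans[OF Q_nonneg Q_le_Qlim] by (intro bdd_belowI[of _ 0]) auto
  have "\<exists>x\<in>{-C..C}. Qlim x < c + 1 / real (Suc n)" for n
    using cINF_less_iff[OF ne bdd, of "c + 1 / real (Suc n)"] by (simp add: c_def)
  then obtain s where s: "\<And>n. s n \<in> {-C..C}" "\<And>n. Qlim (s n) < c + 1 / real (Suc n)"
    by metis
  obtain x0 r where x0: "x0 \<in> {-C..C}" and r: "strict_mono r" "(s \<circ> r) \<longlonglongrightarrow> x0"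
    using compact_Icc[of "- C" C] s(1) unfolding compact_def by metis
  have "Q m x0 \<le> c" for m
  proof (rule LIMSEQ_le)
    have "isCont (Q m) x0" using continuous_Q[of UNIV m] by (simp add: continuous_on_eq_continuous_at)
    then show "(\<lambda>n. Q m ((s \<circ> r) n)) \<longlonglongrightarrow> Q m x0" using r(2) by (rule isCont_tendsto_compose)
    have "(\<lambda>n. c + 1 / real (Suc n)) \<longlonglongrightarrow> c + 0"
      by (intro tendsto_intros LIMSEQ_Suc lim_1_over_n)
    from LIMSEQ_subseq_LIMSEQ[OF this r(1)]
    show "(\<lambda>n. c + 1 / real (Suc (r n))) \<longlonglongrightarrow> c" by (simp add: comp_def)
    show "\<exists>k. \<forall>n\<ge>k. Q m ((s \<circ> r) n) \<le> c + 1 / real (Suc (r n))"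
      using order_trans[OF Q_le_Qlim less_imp_le[OF s(2)]] by auto
  qed
  then have "Qlim x0 \<le> c" unfolding Qlim_def by (intro cSUP_least) auto
  then show ?thesis using x0 cINF_lower[OF bdd] unfolding c_def by (meson order_trans)
qed

text \<open>A zero x of the mask makes exp(2 pi i x) a root of a nonzero polynomial, and each root
  is hit by finitely many x in a bounded interval.\<close>

lemma finite_mask_zeros: "finite {x \<in> {-C..C}. ifs_mask B x = 0}"
proof -
  obtain m where m: "\<And>b. b \<in> B \<Longrightarrow> m \<le> b"
    using finite_B by (meson Min_le)
  \<comment> \<open>Subtracting the lower bound \<open>m\<close> makes all exponents nonnegative, as
    \<open>B\<close> may contain negative digits.\<close>
  define p :: "complex poly" where "p = (\<Sum>b\<in>B. Polynomial.monom 1 (nat (b - m)))"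
  \<comment> \<open>The coefficient belonging to the digit 0 shows that the polynomial is not
    zero.\<close>
  have coeff: "poly.coeff p (nat (0 - m)) = 1"
  proof -
    have "poly.coeff p (nat (0 - m)) = (\<Sum>b\<in>B. if b = 0 then 1 else 0)"
      unfolding p_def coeff_sum using m B0
      by (intro sum.cong refl) (auto simp: nat_eq_iff)
    then show ?thesis using finite_B B0 by simp
  qed
  then have "p \<noteq> 0" by auto
  then have fin: "finite {z. poly p z = 0}" by (rule poly_roots_finite)
  have root: "poly p (expo x 1) = 0" if "ifs_mask B x = 0" for x
  proof -
    have "expo x 1 ^ nat (b - m) = expo x (of_int b) * expo x (of_int (- m))" if "b \<in> B" for b
      using m[OF that] by (simp add: expo_eq_cis cis_mult Complex.DeMoivre algebra_simps)
    then have "poly p (expo x 1) = (\<Sum>b\<in>B. expo x (of_int b)) * expo x (of_int (- m))"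
      by (simp add: p_def poly_sum poly_monom sum_distrib_right)
    then show ?thesis using that card_B by (simp add: ifs_mask_def)
  qed
  have fib: "finite {x \<in> {-C..C}. expo x 1 = z}" for z
  proof (cases "\<exists>x0. expo x0 1 = z")
    case True
    then obtain x0 where x0: "expo x0 1 = z" by blast
    have "{x \<in> {-C..C}. expo x 1 = z} \<subseteq> (\<lambda>k. x0 + of_int k) ` {\<lfloor>- C - x0\<rfloor>..\<lceil>C - x0\<rceil>}"
    proof
      fix x assume x: "x \<in> {x \<in> {-C..C}. expo x 1 = z}"
      have "expo x0 1 * expo (x - x0) 1 = expo x0 1" using x x0 expo_add[of x0 "x - x0" 1] by simp
      moreover have "expo x0 1 \<noteq> 0" by (metis norm_expo norm_zero zero_neq_one)
      ultimately have "expo (x - x0) 1 = 1" by simp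
      then obtain k where k: "x - x0 = of_int k" by (auto simp: expo_eq_1_iff elim: Ints_cases)
      have "k \<in> {\<lfloor>- C - x0\<rfloor>..\<lceil>C - x0\<rceil>}"
        using x k by (auto simp: floor_le_iff le_ceiling_iff)
      then show "x \<in> (\<lambda>k. x0 + of_int k) ` {\<lfloor>- C - x0\<rfloor>..\<lceil>C - x0\<rceil>}" using k by force
    qed
    then show ?thesis by (rule finite_subset) simp
  qed auto
  have "finite (\<Union>z\<in>{z. poly p z = 0}. {x \<in> {-C..C}. expo x 1 = z})"
    using fin fib by auto
  then show ?thesis by (rule finite_subset[rotated]) (use root in auto)
qed

section \<open>Branches of positive weight, path counts and integer cycles\<close>

definition live :: "real \<Rightarrow> int set" where
  "live x = {l \<in> L. ifs_mask B (branch l x) \<noteq> 0}"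

lemma finite_live: "finite (live x)"
  unfolding live_def using finite_L by simp

lemma weight_sum_live: "(\<Sum>l\<in>live x. weight (branch l x)) = 1"
proof -
  have "(\<Sum>l\<in>live x. weight (branch l x)) = (\<Sum>l\<in>L. weight (branch l x))"
    by (rule sum.mono_neutral_left) (auto simp: finite_L live_def weight_def)
  then show ?thesis by (simp add: weight_sum)
qed

lemma live_ne: "live x \<noteq> {}"
  using weight_sum_live[of x] by auto

primrec paths :: "nat \<Rightarrow> real \<Rightarrow> nat" where
  "paths 0 x = 1"
| "paths (Suc n) x = (\<Sum>l\<in>live x. paths n (branch l x))"

text \<open>The weights add up to 1, so every point has a live branch and every path can be
  extended.\<close>

lemma paths_mono: "paths n x \<le> paths (Suc n) x"
proof (induction n arbitrary: x)
  case 0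
  have "card (live x) > 0" using finite_live live_ne by (simp add: card_gt_0_iff)
  then show ?case by simp
next
  case (Suc n)
  have "(\<Sum>l\<in>live x. paths n (branch l x)) \<le> (\<Sum>l\<in>live x. paths (Suc n) (branch l x))"
    by (intro sum_mono Suc)
  then show ?case by simp
qed

lemma paths_ge_1: "paths n x \<ge> 1"
  by (induction n) (auto intro: order_trans[OF _ paths_mono] simp del: paths.simps(2))

text \<open>Distinct paths of equal length that start at the same point end at different points, since the
  digits are incongruent modulo \<open>N\<close>.\<close>

lemma paths_le_card:
  assumes Z: "finite Z" "\<And>x l. x \<in> Z \<Longrightarrow> l \<in> live x \<Longrightarrow> branch l x \<in> Z" and x: "x \<in> Z"
  shows "paths n x \<le> card Z"
proof -
  \<comment> \<open>A path of length \<open>n\<close> is recorded by the integer \<open>k\<close>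
    with digits along the path; its end point is (x + k)/N^n. Both the path and the end point
    determine \<open>k\<close> uniquely, and vice versa.\<close>
  define E where "E n x = {k \<in> Lam n. (x + of_int k) / of_int N ^ n \<in> Z}" for n x
  have fin: "finite (E n x)" for n x unfolding E_def using finite_Lam by simp
  have "paths n x \<le> card (E n x)" using x
  proof (induction n arbitrary: x)
    case 0
    then have "E 0 x = {0}" by (auto simp: E_def)
    then show ?case by simp
  next
    case (Suc n)
    have "paths (Suc n) x \<le> (\<Sum>l\<in>live x. card (E n (branch l x)))"
      unfolding paths.simps by (intro sum_mono Suc.IH Z(2)[OF Suc.prems])
    also have "\<dots> = card (SIGMA l:live x. E n (branch l x))"
      using finite_live fin by simp
    also have "\<dots> \<le> card (E (Suc n) x)"
    proof (rule card_inj_on_le[OF _ _ fin])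
      show "inj_on (\<lambda>(l, k). l + N * k) (SIGMA l:live x. E n (branch l x))"
        by (rule inj_on_subset[OF inj_digit[of UNIV]]) (auto simp: live_def)
      have "(x + of_int (l + N * k)) / of_int N ^ Suc n = (branch l x + of_int k) / of_int N ^ n" for l k
        using N by (simp add: branch_def field_simps)
      then show "(\<lambda>(l, k). l + N * k) ` (SIGMA l:live x. E n (branch l x)) \<subseteq> E (Suc n) x"
        by (auto simp: E_def live_def)
    qed
    finally show ?case .
  qed
  also have "card (E n x) \<le> card Z"
  proof (rule card_inj_on_le[OF _ _ Z(1)])
    show "inj_on (\<lambda>k. (x + of_int k) / of_int N ^ n) (E n x)"
      using N by (auto simp: inj_on_def)
  qed (auto simp: E_def)
  finally show ?thesis .
qed

text \<open>Bounded path counts must stop growing. Where the stable count is least, two live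
  branches would already give too many paths, so there the dynamics is deterministic; its single
  branch has weight 1 and leads to an integer.\<close>

lemma invariant_contains_integer_cycle:
  assumes Z: "finite Z" "Z \<noteq> {}" "\<And>x l. x \<in> Z \<Longrightarrow> l \<in> live x \<Longrightarrow> branch l x \<in> Z"
  shows "\<exists>S::int set. finite S \<and> S \<noteq> {} \<and> of_int ` S \<subseteq> Z \<and> (\<forall>x\<in>S. \<exists>l\<in>L. \<exists>y\<in>S. N * y = x + l)"
proof -
  have "(\<Sum>x\<in>Z. paths n x) \<le> card Z * card Z" for n
    using sum_bounded_above[of Z "paths n" "card Z"] paths_le_card[OF Z(1,3)] by simp
  \<comment> \<open>The totals over \<open>Z\<close> are bounded, so some \<open>n\<close> maximizes
    them. By monotonicity, the counts at each point of \<open>Z\<close> are then the same for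
    \<open>n\<close> and \<open>Suc n\<close>.\<close>
  then obtain n where max: "\<And>k. (\<Sum>x\<in>Z. paths k x) \<le> (\<Sum>x\<in>Z. paths n x)"
    using ex_has_greatest_nat[of "\<lambda>_. True" 0 "\<lambda>n. \<Sum>x\<in>Z. paths n x" "Suc (card Z * card Z)"]
    by (auto simp: less_Suc_eq_le)
  define F where "F = paths n"
  have F: "F x = (\<Sum>l\<in>live x. F (branch l x))" if "x \<in> Z" for x
  proof -
    have "(\<Sum>x\<in>Z. paths (Suc n) x) = (\<Sum>x\<in>Z. paths n x)"
      using max[of "Suc n"] sum_mono[of Z "paths n" "paths (Suc n)"] paths_mono by (simp add: antisym)
    then have "paths (Suc n) x = paths n x"
      using sum_mono_inv[of "paths n" Z "paths (Suc n)" x] paths_mono Z(1) that by metis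
    then show ?thesis by (simp add: F_def)
  qed
  define k where "k = Min (F ` Z)"
  have k_le: "k \<le> F x" if "x \<in> Z" for x unfolding k_def using Z that by simp
  have "k \<in> F ` Z" unfolding k_def using Z(1,2) by (intro Min_in) auto
  then obtain z where z: "z \<in> Z" "F z = k" by blast
  have k_pos: "k > 0" using paths_ge_1[of n z] z(2) by (simp add: F_def)
  define Y where "Y = {x \<in> Z. F x = k}"
  have Y_ne: "Y \<noteq> {}" using z by (auto simp: Y_def)
  have single: "\<exists>l. live x = {l} \<and> branch l x \<in> Y" if "x \<in> Y" for x
  proof -
    have x: "x \<in> Z" "F x = k" using that by (auto simp: Y_def)
    have "card (live x) * k \<le> (\<Sum>l\<in>live x. F (branch l x))"
      using sum_bounded_below[of "live x" k "\<lambda>l. F (branch l x)"] k_le Z(3)[OF x(1)] by simp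
    then have "card (live x) * k \<le> 1 * k" using F[OF x(1)] x(2) by simp
    then have "card (live x) \<le> 1" using k_pos mult_le_cancel2 by blast
    then have "card (live x) = 1"
      using finite_live[of x] live_ne[of x] by (simp add: le_Suc_eq)
    then obtain l where l: "live x = {l}" by (auto simp: card_1_singleton_iff)
    then have "F (branch l x) = k" using F[OF x(1)] x(2) by simp
    then show ?thesis using l Z(3)[OF x(1)] by (auto simp: Y_def)
  qed
  have step: "\<exists>l\<in>L. \<exists>y. branch l x = of_int y \<and> of_int y \<in> Y" if x: "x \<in> Y" for x
  proof -
    obtain l where l: "live x = {l}" "branch l x \<in> Y" using single[OF x] by blast
    \<comment> \<open>Weight 1 means mask modulus 1, so all exponentials over \<open>B\<close> equal
      1, and \<open>Gcd B = 1\<close> makes the new point an integer.\<close>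
    have "weight (branch l x) = 1" using weight_sum_live[of x] l by simp
    then have "cmod (ifs_mask B (branch l x)) = 1" by (simp add: weight_def abs_square_eq_1)
    then have "expo (branch l x) (of_int b) = 1" if "b \<in> B" for b
      using cmod_mask_eq_1[OF finite_B B0] that by blast
    then have "of_int (Gcd B) * branch l x \<in> \<int>"
      by (intro Gcd_mult_in_Ints finite_B) (simp add: expo_eq_1_iff mult.commute)
    then obtain y where "branch l x = of_int y" using Gcd_B by (auto elim: Ints_cases)
    moreover have "l \<in> L" using l(1) by (auto simp: live_def)
    ultimately show ?thesis using l(2) by metis
  qed
  \<comment> \<open>Nonempty although \<open>Y\<close> may contain other points as well: the
    successor of any point of \<open>Y\<close> is an integer in \<open>Y\<close>.\<close>
  define S where "S = {y::int. of_int y \<in> Y}"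
  have "finite (of_int -` Z :: int set)" by (rule finite_vimageI[OF Z(1)]) (auto simp: inj_on_def)
  then have "finite S" by (rule rev_finite_subset) (auto simp: S_def Y_def)
  moreover have "S \<noteq> {}" using Y_ne step by (fastforce simp: S_def)
  moreover have "of_int ` S \<subseteq> Z" by (auto simp: S_def Y_def)
  moreover have "\<exists>l\<in>L. \<exists>y\<in>S. N * y = x + l" if x: "x \<in> S" for x
  proof -
    obtain l y where l: "l \<in> L" "branch l (of_int x) = of_int y" "of_int y \<in> Y"
      using step x unfolding S_def by blast
    then have "of_int (N * y) = (of_int (x + l) :: real)" using N by (simp add: branch_def field_simps)
    then show ?thesis using l unfolding of_int_eq_iff by (auto simp: S_def)
  qed
  ultimately show ?thesis by blast
qed

end

section \<open>Completeness in the absence of nonzero integer cycles\<close>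

locale cycle_free_ifs = hadamard_ifs +
  assumes cycle_free: "finite S \<Longrightarrow> S \<noteq> {} \<Longrightarrow> (\<And>x. x \<in> S \<Longrightarrow> \<exists>l\<in>L. \<exists>y\<in>S. N * y = x + l) \<Longrightarrow> 0 \<in> S"
begin

text \<open>This is Parseval's identity for every exponential: its projections onto the spans of the
  frequencies in \<open>Lam n\<close> exhaust its length.\<close>

lemma Qlim_eq_1: "Qlim x = 1"
proof -
  define K where "K = (\<Sum>l\<in>L. \<bar>real_of_int l\<bar>)"
  \<comment> \<open>The interval from -C to C contains \<open>x\<close> and is mapped into itself by
    all branches, because |y + l| \<le> 2C \<le> NC.\<close>
  define C where "C = max \<bar>x\<bar> K"
  have K: "\<bar>real_of_int l\<bar> \<le> K" if "l \<in> L" for l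
    unfolding K_def using that finite_L by (intro member_le_sum) auto
  have C0: "C \<ge> 0" by (simp add: C_def le_max_iff_disj)
  have inv: "branch l y \<in> {-C..C}" if "y \<in> {-C..C}" "l \<in> L" for y l
  proof -
    have "\<bar>y + of_int l\<bar> \<le> C + C" using that K[of l] by (auto simp: C_def)
    also have "\<dots> \<le> C * of_int N" using mult_left_mono[of 2 "real_of_int N" C] C0 N by simp
    finally have "\<bar>branch l y\<bar> \<le> C" using N by (simp add: branch_def pos_divide_le_eq)
    then show ?thesis by auto
  qed
  obtain x0 where x0: "x0 \<in> {-C..C}" and min: "\<And>y. y \<in> {-C..C} \<Longrightarrow> Qlim x0 \<le> Qlim y"
    using Qlim_attains_min[OF C0] by blast
  define Z where "Z = {y \<in> {-C..C}. Qlim y = Qlim x0}"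
  \<comment> \<open>\<open>Qlim y\<close> is a weighted average of values that are at least the
    minimum; if it equals the minimum, so does every value of positive weight.\<close>
  have Z_inv: "branch l y \<in> Z" if y: "y \<in> Z" and l: "l \<in> live y" for y l
  proof -
    have in_C: "branch k y \<in> {-C..C}" if "k \<in> L" for k using inv y that by (auto simp: Z_def)
    have "(\<Sum>k\<in>L. weight (branch k y) * (Qlim (branch k y) - Qlim x0)) = Qlim y - Qlim x0"
      using Qlim_eq[of y] weight_sum[of y]
      by (simp add: right_diff_distrib sum_subtractf flip: sum_distrib_right)
    also have "\<dots> = 0" using y by (simp add: Z_def)
    finally have "\<forall>k\<in>L. weight (branch k y) * (Qlim (branch k y) - Qlim x0) = 0"
      using min[OF in_C] weight_nonneg
      by (subst (asm) sum_nonneg_eq_0_iff[OF finite_L]) auto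
    then show ?thesis using l in_C by (auto simp: Z_def live_def weight_def)
  qed
  have "Qlim x0 = 1"
  proof (rule ccontr)
    assume "Qlim x0 \<noteq> 1"
    then have less: "Qlim x0 < 1" using Qlim_le_1[of x0] by simp
    have cont0: "isCont (Q 0) 0"
      using continuous_Q[of UNIV 0] by (simp add: continuous_on_eq_continuous_at del: Q.simps)
    have Q0: "Q 0 0 = 1" by (simp add: fourier_0)
    have pow_lim: "(\<lambda>n. y / of_int N ^ n) \<longlonglongrightarrow> 0" for y :: real
    proof -
      have "(\<lambda>n. y * (1 / real_of_int N) ^ n) \<longlonglongrightarrow> y * 0"
        by (intro tendsto_mult tendsto_const LIMSEQ_power_zero) (use N in simp)
      then show ?thesis by (simp add: power_one_over)
    qed
    \<comment> \<open>Otherwise the digit 0 is live all along, the points y/N^n stay in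
      \<open>Z\<close> and tend to 0, and continuity of \<open>Q 0\<close> at 0 gives 1 \<le>
      \<open>Qlim x0\<close>.\<close>
    have zero: "\<exists>n. ifs_mask B (y / of_int N ^ n) = 0" if y: "y \<in> Z" for y
    proof (rule ccontr)
      assume nz: "\<nexists>n. ifs_mask B (y / of_int N ^ n) = 0"
      have in_Z: "y / of_int N ^ n \<in> Z" for n
      proof (induction n)
        case (Suc n)
        have eq: "branch 0 (y / of_int N ^ n) = y / of_int N ^ Suc n" by (simp add: branch_def field_simps)
        then have "0 \<in> live (y / of_int N ^ n)"
          unfolding live_def using L0 nz by (simp del: power_Suc)
        then show ?case using Z_inv[OF Suc] eq by metis
      qed (use y in simp)
      have "(\<lambda>n. Q 0 (y / of_int N ^ n)) \<longlonglongrightarrow> Q 0 0"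
        by (rule isCont_tendsto_compose[OF cont0 pow_lim])
      then have "Q 0 0 \<le> Qlim x0"
      proof (rule LIMSEQ_le_const2)
        have "Q 0 (y / of_int N ^ n) \<le> Qlim x0" for n
          using Q_le_Qlim[of 0 "y / of_int N ^ n"] in_Z[of n] by (simp add: Z_def)
        then show "\<exists>m. \<forall>n\<ge>m. Q 0 (y / of_int N ^ n) \<le> Qlim x0" by blast
      qed
      then show False using Q0 less by simp
    qed
    have "finite Z"
    proof -
      have "isCont (ifs_mask B) 0" using continuous_mask[of UNIV B] by (simp add: continuous_on_eq_continuous_at)
      then have "((ifs_mask B) \<longlongrightarrow> 1) (at 0)"
        using mask_int[OF finite_B B_ne, of 0] by (simp add: isCont_def)
      then have "eventually (\<lambda>t. dist (ifs_mask B t) 1 < 1) (at 0)" by (rule tendstoD) simp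
      then obtain \<delta> where \<delta>: "\<delta> > 0" "\<And>t. t \<noteq> 0 \<Longrightarrow> dist t 0 < \<delta> \<Longrightarrow> dist (ifs_mask B t) 1 < 1"
        unfolding eventually_at by auto
      have nz: "ifs_mask B t \<noteq> 0" if "\<bar>t\<bar> < \<delta>" for t
        using \<delta>(2)[of t] that mask_int[OF finite_B B_ne, of 0] by (cases "t = 0") auto
      have "eventually (\<lambda>n. C / of_int N ^ n < \<delta>) sequentially"
        by (rule order_tendstoD(2)[OF pow_lim \<delta>(1)])
      then obtain m where m: "\<And>n. n \<ge> m \<Longrightarrow> C / of_int N ^ n < \<delta>"
        unfolding eventually_sequentially by blast
      \<comment> \<open>The mask does not vanish near 0, so the zero y/N^n found above has n < m;
        hence \<open>y\<close> is one of finitely many zeros times one of finitely many powers of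
        \<open>N\<close>.\<close>
      have "Z \<subseteq> (\<Union>n<m. (\<lambda>t. t * of_int N ^ n) ` {t \<in> {-C..C}. ifs_mask B t = 0})"
      proof
        fix y assume y: "y \<in> Z"
        then obtain n where n: "ifs_mask B (y / of_int N ^ n) = 0" using zero by blast
        have yC: "\<bar>y\<bar> \<le> C" using y by (auto simp: Z_def)
        have N1: "real_of_int N ^ n \<ge> 1" using N by (simp add: one_le_power)
        have le: "\<bar>y / of_int N ^ n\<bar> \<le> C / of_int N ^ n"
          using yC N by (simp add: divide_right_mono)
        have "n < m"
          using n nz[of "y / of_int N ^ n"] le m[of n] by (meson leI le_less_trans)
        moreover have "C / of_int N ^ n \<le> C" using N1 C0 by (simp add: divide_le_eq mult_le_cancel_left1)
        then have "y / of_int N ^ n \<in> {-C..C}" using le unfolding atLeastAtMost_iff by linarith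
        moreover have "y = y / of_int N ^ n * of_int N ^ n" using N by simp
        ultimately show "y \<in> (\<Union>n<m. (\<lambda>t. t * of_int N ^ n) ` {t \<in> {-C..C}. ifs_mask B t = 0})"
          using n by blast
      qed
      then show ?thesis by (rule finite_subset) (use finite_mask_zeros in auto)
    qed
    have "Z \<noteq> {}" using x0 by (auto simp: Z_def)
    from invariant_contains_integer_cycle[OF \<open>finite Z\<close> \<open>Z \<noteq> {}\<close> Z_inv]
    obtain S :: "int set" where S: "finite S" "S \<noteq> {}" "of_int ` S \<subseteq> Z"
      "\<forall>x\<in>S. \<exists>l\<in>L. \<exists>y\<in>S. N * y = x + l"
      by metis
    have "0 \<in> S" by (rule cycle_free[OF S(1,2)]) (rule S(4)[rule_format])
    then have "0 \<in> Z" using S(3) by auto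
    then have "Qlim 0 < 1" using less by (simp add: Z_def)
    then show False using Q_le_Qlim[of 0 0] Q0 by simp
  qed
  moreover have "x \<in> {-C..C}" by (auto simp: C_def)
  ultimately show ?thesis using min[of x] Qlim_le_1[of x] by simp
qed

lemma expo_inner: "L2_inner \<mu> (expo a) (expo b) = fourier \<mu> (a - b)"
proof -
  have "expo a x * cnj (expo b x) = expo (a - b) x" for x
    using expo_add[of a "- b" x] by (simp add: cnj_expo)
  then show ?thesis by (simp add: L2_inner_def fourier_def)
qed

lemma integrable_expo: "integrable \<mu> (expo a)"
  by (rule integrable_const_bound[of _ 1]) auto

text \<open>Pythagoras for an orthonormal system. The frequency is negated because the coefficient
  at \<open>k\<close> is the Fourier transform at \<open>- \<xi> - of_int k\<close>, the conjugate
  of its value at \<open>\<xi> + of_int k\<close>.\<close>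

lemma projection_error:
  "(LINT x|\<mu>. (cmod (expo (- \<xi>) x - (\<Sum>k\<in>Lam n. fourier \<mu> (- \<xi> - of_int k) * expo (of_int k) x)))\<^sup>2) = 1 - Q n \<xi>"
proof -
  define c where "c k = fourier \<mu> (- \<xi> - of_int k)" for k :: int
  define v where "v x = (\<Sum>k\<in>Lam n. c k * expo (of_int k) x)" for x
  have cnj_c: "cnj (c k) = fourier \<mu> (of_int k + \<xi>)" for k
  proof -
    have "fourier \<mu> (of_int k + \<xi>) = (LINT x|\<mu>. cnj (expo (- \<xi> - of_int k) x))"
      by (simp add: fourier_def cnj_expo add.commute del: integral_cnj)
    then show ?thesis by (simp add: c_def fourier_def)
  qed
  have pt: "complex_of_real ((cmod (expo (- \<xi>) x - v x))\<^sup>2) =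
      1 - (\<Sum>k\<in>Lam n. cnj (c k) * expo (- \<xi> - of_int k) x) - (\<Sum>k\<in>Lam n. c k * expo (of_int k + \<xi>) x)
      + (\<Sum>k\<in>Lam n. \<Sum>j\<in>Lam n. c k * cnj (c j) * expo (of_int k - of_int j) x)" for x
  proof -
    have e: "expo a x * cnj (expo b x) = expo (a - b) x" for a b
      using expo_add[of a "- b" x] by (simp add: cnj_expo)
    have "complex_of_real ((cmod (expo (- \<xi>) x - v x))\<^sup>2) = (expo (- \<xi>) x - v x) * cnj (expo (- \<xi>) x - v x)"
      by (rule complex_norm_square)
    also have "\<dots> = expo (- \<xi>) x * cnj (expo (- \<xi>) x) - expo (- \<xi>) x * cnj (v x)
        - v x * cnj (expo (- \<xi>) x) + v x * cnj (v x)"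
      by (simp add: algebra_simps)
    also have "expo (- \<xi>) x * cnj (expo (- \<xi>) x) = 1" by (simp add: e)
    also have "expo (- \<xi>) x * cnj (v x) = (\<Sum>k\<in>Lam n. cnj (c k) * expo (- \<xi> - of_int k) x)"
      unfolding v_def by (simp add: sum_distrib_left mult.left_commute flip: e)
    also have "v x * cnj (expo (- \<xi>) x) = (\<Sum>k\<in>Lam n. c k * expo (of_int k + \<xi>) x)"
      unfolding v_def using e[of _ "- \<xi>"] by (simp add: sum_distrib_right mult.assoc)
    also have "v x * cnj (v x) = (\<Sum>k\<in>Lam n. \<Sum>j\<in>Lam n. c k * cnj (c j) * expo (of_int k - of_int j) x)"
      unfolding v_def by (simp add: sum_product mult_ac flip: e)
    finally show ?thesis .
  qed
  have orth: "fourier \<mu> (of_int k - of_int j) = (if j = k then 1 else 0)" if "k \<in> Lam n" "j \<in> Lam n" for k j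
    using fourier_orthogonal[OF that] fourier_0 by auto
  have "complex_of_real (LINT x|\<mu>. (cmod (expo (- \<xi>) x - v x))\<^sup>2) = (LINT x|\<mu>. complex_of_real ((cmod (expo (- \<xi>) x - v x))\<^sup>2))"
    by (simp del: of_real_power)
  also have "\<dots> = 1 - (\<Sum>k\<in>Lam n. cnj (c k) * fourier \<mu> (- \<xi> - of_int k)) - (\<Sum>k\<in>Lam n. c k * fourier \<mu> (of_int k + \<xi>))
      + (\<Sum>k\<in>Lam n. \<Sum>j\<in>Lam n. c k * cnj (c j) * fourier \<mu> (of_int k - of_int j))"
    unfolding pt fourier_def using prob_space
    by (simp add: integrable_expo)
  also have "(\<Sum>k\<in>Lam n. cnj (c k) * fourier \<mu> (- \<xi> - of_int k)) = (\<Sum>k\<in>Lam n. c k * cnj (c k))"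
    by (simp add: c_def[symmetric] mult.commute)
  also have "(\<Sum>k\<in>Lam n. c k * fourier \<mu> (of_int k + \<xi>)) = (\<Sum>k\<in>Lam n. c k * cnj (c k))"
    by (simp add: cnj_c)
  also have "(\<Sum>k\<in>Lam n. \<Sum>j\<in>Lam n. c k * cnj (c j) * fourier \<mu> (of_int k - of_int j)) = (\<Sum>k\<in>Lam n. c k * cnj (c k))"
    by (intro sum.cong refl) (simp add: orth finite_Lam if_distrib cong: if_cong)
  also have "1 - (\<Sum>k\<in>Lam n. c k * cnj (c k)) - (\<Sum>k\<in>Lam n. c k * cnj (c k)) + (\<Sum>k\<in>Lam n. c k * cnj (c k))
     = 1 - complex_of_real (\<Sum>k\<in>Lam n. (cmod (c k))\<^sup>2)"
    by (simp add: complex_norm_square del: of_real_power)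
  also have "(\<Sum>k\<in>Lam n. (cmod (c k))\<^sup>2) = Q n \<xi>"
    unfolding Q_eq using cnj_c complex_mod_cnj by (intro sum.cong refl) (metis add.commute)
  finally have "complex_of_real (LINT x|\<mu>. (cmod (expo (- \<xi>) x - v x))\<^sup>2) = complex_of_real (1 - Q n \<xi>)" by simp
  then show ?thesis unfolding of_real_eq_iff v_def c_def .
qed

lemma Lam_mono: "Lam n \<subseteq> Lam (Suc n)"
proof (induction n)
  case 0
  then show ?case using L0 by force
next
  case (Suc n)
  then show ?case by (auto simp del: Lam.simps simp add: Lam.simps(2))
qed

text \<open>An expansion with upper index \<open>n\<close> has n + 1 digits and so corresponds to
  \<open>Lam (Suc n)\<close>.\<close>

lemma Lambda_set_eq: "Lambda_set N L = of_int ` (\<Union>n. Lam n)"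
proof -
  have sum_in: "(\<Sum>k=0..n. l k * N ^ k) \<in> Lam (Suc n)" if "\<forall>k\<in>{0..n}. l k \<in> L" for n l
    using that
  proof (induction n arbitrary: l)
    case 0
    then show ?case by force
  next
    case (Suc n)
    define t where "t = (\<Sum>k=0..n. l (Suc k) * N ^ k)"
    have "(\<Sum>k=0..Suc n. l k * N ^ k) = l 0 + N * t"
      by (simp add: t_def sum.atLeast0_atMost_Suc_shift sum_distrib_left mult_ac del: sum.cl_ivl_Suc)
    moreover have "t \<in> Lam (Suc n)" unfolding t_def using Suc.prems by (intro Suc.IH) auto
    moreover have "l 0 \<in> L" using Suc.prems by simp
    ultimately show ?case unfolding Lam.simps(2)[of "Suc n"] by (intro image_eqI[of _ _ "(l 0, t)"] SigmaI) simp_all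
  qed
  have ex_digits: "\<exists>l. (\<forall>k\<in>{0..n}. l k \<in> L) \<and> s = (\<Sum>k=0..n. l k * N ^ k)" if "s \<in> Lam (Suc n)" for n s
    using that
  proof (induction n arbitrary: s)
    case 0
    then show ?case by (intro exI[of _ "\<lambda>_. s"]) auto
  next
    case (Suc n)
    then obtain d t where d: "d \<in> L" "t \<in> Lam (Suc n)" "s = d + N * t"
      unfolding Lam.simps(2)[of "Suc n"] by auto
    obtain l where l: "\<forall>k\<in>{0..n}. l k \<in> L" "t = (\<Sum>k=0..n. l k * N ^ k)" using Suc.IH d(2) by blast
    have "s = (\<Sum>k=0..Suc n. case_nat d l k * N ^ k)"
      by (simp add: d(3) l(2) sum.atLeast0_atMost_Suc_shift sum_distrib_left mult_ac del: sum.cl_ivl_Suc)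
    moreover have "\<forall>k\<in>{0..Suc n}. case_nat d l k \<in> L" using d l by (auto split: nat.split)
    ultimately show ?case by blast
  qed
  show ?thesis
  proof (intro equalityI subsetI)
    fix x assume "x \<in> Lambda_set N L"
    then obtain n l where "x = of_int (\<Sum>k=0..n. l k * N ^ k)" "\<forall>k\<in>{0..n}. l k \<in> L"
      unfolding Lambda_set_def by blast
    then show "x \<in> of_int ` (\<Union>n. Lam n)" using sum_in by blast
  next
    fix x :: real assume "x \<in> of_int ` (\<Union>n. Lam n)"
    then obtain n s where s: "x = of_int s" "s \<in> Lam n" by auto
    \<comment> \<open>Padding with two leading zeros makes the upper index \<open>Suc n\<close>,
      which meets the requirement of being at least 1.\<close>
    then have "s \<in> Lam (Suc (Suc n))" using Lam_mono by blast
    then obtain l where "\<forall>k\<in>{0..Suc n}. l k \<in> L" "s = (\<Sum>k=0..Suc n. l k * N ^ k)"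
      using ex_digits by blast
    then show "x \<in> Lambda_set N L"
      unfolding Lambda_set_def s(1) by (intro CollectI exI[of _ "Suc n"] exI[of _ l]) auto
  qed
qed

text \<open>Orthonormality comes from \<open>fourier_orthogonal\<close> at a common length. For
  density, \<open>Qlim_eq_1\<close> puts every exponential into the closure of the span, and
  \<open>dense_cl\<close> then gives all of L2.\<close>

lemma spectral_pair: "spectral_pair (self_similar_measure N B) (Lambda_set N L)"
proof -
  define \<Lambda> where "\<Lambda> = Lambda_set N L"
  define V where "V = {\<lambda>x. \<Sum>t\<in>F. c t * expo t x | F c. finite F \<and> F \<subseteq> \<Lambda>}"
  have expo_sq: "square_integrable \<mu> (expo t)" for t
    unfolding square_integrable_def by simp
  have Lam_sub: "of_int ` Lam n \<subseteq> \<Lambda>" for n unfolding \<Lambda>_def Lambda_set_eq by blast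
  interpret V: L2_subspace \<mu> V
  proof
    fix v assume "v \<in> V"
    then obtain F c where v: "finite F" "v = (\<lambda>x. \<Sum>t\<in>F. c t * expo t x)" by (auto simp: V_def)
    have "square_integrable \<mu> (\<lambda>x. \<Sum>t\<in>F. c t * expo t x)"
      using v(1)
    proof (induction F rule: finite_induct)
      case empty
      then show ?case by (simp add: square_integrable_def)
    next
      case (insert t F)
      then show ?case using square_integrable_add[OF square_integrable_scale[OF expo_sq]] by simp
    qed
    then show "square_integrable \<mu> v" using v by simp
  next
    show "(\<lambda>_. 0) \<in> V" unfolding V_def by (auto intro!: exI[of _ "{}"])
  next
    fix v w assume "v \<in> V" "w \<in> V"
    then obtain F c G d where F: "finite F" "F \<subseteq> \<Lambda>" "v = (\<lambda>x. \<Sum>t\<in>F. c t * expo t x)"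
      and G: "finite G" "G \<subseteq> \<Lambda>" "w = (\<lambda>x. \<Sum>t\<in>G. d t * expo t x)" by (auto simp: V_def)
    define e where "e t = (if t \<in> F then c t else 0) + (if t \<in> G then d t else 0)" for t
    have "(\<Sum>t\<in>F \<union> G. (if t \<in> F then c t else 0) * expo t x) = v x" for x
      unfolding F(3) using F(1) G(1) by (intro sum.mono_neutral_cong_right) auto
    moreover have "(\<Sum>t\<in>F \<union> G. (if t \<in> G then d t else 0) * expo t x) = w x" for x
      unfolding G(3) using F(1) G(1) by (intro sum.mono_neutral_cong_right) auto
    ultimately have "(\<lambda>x. v x + w x) = (\<lambda>x. \<Sum>t\<in>F \<union> G. e t * expo t x)"
      by (simp add: e_def distrib_right sum.distrib)
    then show "(\<lambda>x. v x + w x) \<in> V" unfolding V_def using F G by blast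
  next
    fix v c assume "v \<in> V"
    then obtain F d where F: "finite F" "F \<subseteq> \<Lambda>" "v = (\<lambda>x. \<Sum>t\<in>F. d t * expo t x)" by (auto simp: V_def)
    then have "(\<lambda>x. c * v x) = (\<lambda>x. \<Sum>t\<in>F. (c * d t) * expo t x)"
      by (simp add: sum_distrib_left mult.assoc)
    then show "(\<lambda>x. c * v x) \<in> V" unfolding V_def using F by (intro CollectI exI conjI) auto
  qed
  have expo_cl: "expo \<xi> \<in> V.cl" for \<xi>
  proof (unfold V.cl_def, intro CollectI conjI allI impI expo_sq)
    fix \<epsilon> :: real assume "\<epsilon> > 0"
    have "(\<lambda>n. 1 - Q n (- \<xi>)) \<longlonglongrightarrow> 1 - 1"
      using Q_tendsto[of "- \<xi>"] unfolding Qlim_eq_1 by (intro tendsto_intros)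
    then have "eventually (\<lambda>n. 1 - Q n (- \<xi>) < \<epsilon>) sequentially"
      using order_tendstoD(2) \<open>\<epsilon> > 0\<close> by force
    then obtain n where n: "1 - Q n (- \<xi>) < \<epsilon>" by (auto simp: eventually_sequentially)
    define v where "v x = (\<Sum>k\<in>Lam n. fourier \<mu> (\<xi> - of_int k) * expo (of_int k) x)" for x
    have "v x = (\<Sum>t\<in>of_int ` Lam n. fourier \<mu> (\<xi> - t) * expo t x)" for x
      unfolding v_def by (subst sum.reindex) (auto simp: inj_on_def)
    then have "v \<in> V" unfolding V_def using finite_Lam[of n] Lam_sub[of n]
      by (intro CollectI exI[of _ "of_int ` Lam n"] exI[of _ "\<lambda>t. fourier \<mu> (\<xi> - t)"]) auto
    moreover have "(LINT x|\<mu>. (cmod (expo \<xi> x - v x))\<^sup>2) < \<epsilon>"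
      using projection_error[of "- \<xi>" n] n by (simp add: v_def)
    ultimately show "\<exists>v\<in>V. (LINT x|\<mu>. (cmod (expo \<xi> x - v x))\<^sup>2) < \<epsilon>" by blast
  qed
  obtain R where R: "AE x in \<mu>. \<bar>x\<bar> \<le> R" using bounded_support by blast
  have "L2_orthonormal_basis \<mu> expo \<Lambda>"
    unfolding L2_orthonormal_basis_def
  proof (intro conjI ballI allI impI expo_sq)
    fix s t assume "s \<in> \<Lambda>" "t \<in> \<Lambda>"
    then obtain m n j k where s: "s = of_int j" "j \<in> Lam m" and t: "t = of_int k" "k \<in> Lam n"
      unfolding \<Lambda>_def Lambda_set_eq by auto
    have "Lam m \<subseteq> Lam (max m n)" "Lam n \<subseteq> Lam (max m n)"
      using lift_Suc_mono_le[of Lam, OF Lam_mono] by auto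
    then have "j \<noteq> k \<Longrightarrow> fourier \<mu> (of_int (j - k)) = 0"
      using s(2) t(2) by (intro fourier_orthogonal[of _ "max m n"]) auto
    then show "L2_inner \<mu> (expo s) (expo t) = (if s = t then 1 else 0)"
      unfolding expo_inner s(1) t(1) using fourier_0 by auto
  next
    fix f \<epsilon> assume f: "square_integrable \<mu> f" and \<epsilon>: "(\<epsilon>::real) > 0"
    have "f \<in> V.cl" by (rule V.dense_cl[OF R expo_cl f])
    then obtain v where v: "v \<in> V" "(LINT x|\<mu>. (cmod (f x - v x))\<^sup>2) < \<epsilon>\<^sup>2"
      using \<epsilon> by (force simp: V.cl_def dest: spec[of _ "\<epsilon>\<^sup>2"])
    then have "L2_norm \<mu> (\<lambda>x. f x - v x) < \<epsilon>"
      unfolding L2_norm_def using \<epsilon> by (intro real_less_lsqrt) auto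
    then show "\<exists>F c. finite F \<and> F \<subseteq> \<Lambda> \<and> L2_norm \<mu> (\<lambda>x. f x - (\<Sum>i\<in>F. c i * expo i x)) < \<epsilon>"
      using v(1) by (auto simp: V_def)
  qed
  moreover have "countable \<Lambda>" unfolding \<Lambda>_def Lambda_set_eq by (rule countable_image) simp
  ultimately show ?thesis
    using borel_prob by (simp add: spectral_pair_def \<Lambda>_def \<mu>_def)
qed

end

section \<open>Prime eigenvalues\<close>

text \<open>Multiplying the spectrum by an integer amounts to multiplying the digits, so the
  criterion for spectra can be applied to the scaled digit set.\<close>

lemma Lambda_set_scale: "Lambda_set N ((\<lambda>l. c * l) ` L) = (*) (real_of_int c) ` Lambda_set N L"
proof (intro equalityI subsetI)
  fix x assume "x \<in> Lambda_set N ((\<lambda>l. c * l) ` L)"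
  then obtain n l where l: "x = of_int (\<Sum>k=0..n. l k * N ^ k)" "1 \<le> n" "\<forall>k\<in>{0..n}. l k \<in> (\<lambda>l. c * l) ` L"
    unfolding Lambda_set_def by blast
  then obtain l' where l': "\<forall>k\<in>{0..n}. l' k \<in> L \<and> l k = c * l' k" unfolding image_iff by metis
  have "(\<Sum>k=0..n. l k * N ^ k) = c * (\<Sum>k=0..n. l' k * N ^ k)"
    unfolding sum_distrib_left using l' by (intro sum.cong refl) auto
  moreover have "of_int (\<Sum>k=0..n. l' k * N ^ k) \<in> Lambda_set N L"
    unfolding Lambda_set_def using l(2) l' by blast
  ultimately show "x \<in> (*) (real_of_int c) ` Lambda_set N L"
    unfolding l(1) by (simp only: of_int_mult imageI)
next
  fix x assume "x \<in> (*) (real_of_int c) ` Lambda_set N L"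
  then obtain n l where l: "x = of_int c * of_int (\<Sum>k=0..n. l k * N ^ k)" "1 \<le> n" "\<forall>k\<in>{0..n}. l k \<in> L"
    unfolding Lambda_set_def by blast
  have "x = of_int (\<Sum>k=0..n. (c * l k) * N ^ k)"
    unfolding l(1) by (simp add: sum_distrib_left mult.assoc)
  then show "x \<in> Lambda_set N ((\<lambda>l. c * l) ` L)" unfolding Lambda_set_def using l(2,3)
    by (intro CollectI exI[of _ n] exI[of _ "\<lambda>k. c * l k"]) auto
qed

text \<open>On a subset permuted by a choice of branches, every point is a multiple of
  \<open>d\<close>. After division by \<open>d\<close>, each point has a predecessor, and the
  extreme points yield the bounds of the attractor.\<close>

lemma periodic_points_bounds:
  fixes N p d lo hi :: int and E S :: "int set"
  assumes N: "N \<ge> 3" "d > 0" "d dvd N" and p: "p > 0"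
    and S: "finite S" "S \<noteq> {}" "\<And>x. x \<in> S \<Longrightarrow> \<exists>e\<in>E. \<exists>y\<in>S. N * y = x + p * (d * e)"
    and E: "\<And>e. e \<in> E \<Longrightarrow> lo \<le> e \<and> e \<le> hi"
  shows "\<exists>T. T \<noteq> {} \<and> (\<lambda>z. d * z) ` T \<subseteq> S \<and> (\<forall>y\<in>T. \<exists>x\<in>T. \<exists>e\<in>E. N * y = x + p * e) \<and>
    (\<forall>y\<in>T. p * lo \<le> (N - 1) * y \<and> (N - 1) * y \<le> p * hi)"
proof -
  obtain f where f: "\<And>x. x \<in> S \<Longrightarrow> f x \<in> S \<and> (\<exists>e\<in>E. N * f x = x + p * (d * e))"
    using S(3) by metis
  obtain C where C: "C \<subseteq> S" "C \<noteq> {}" "f ` C = C"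
    using finite_self_map_image_eq[OF S(1,2), of f] f by blast
  define T where "T = {z. d * z \<in> C}"
  have T_S: "(\<lambda>z. d * z) ` T \<subseteq> S" using C(1) by (auto simp: T_def)
  \<comment> \<open>A point is N times its successor minus a multiple of \<open>d\<close>, and
    \<open>d\<close> divides \<open>N\<close>.\<close>
  have d_dvd: "d dvd c" if c: "c \<in> C" for c
  proof -
    obtain e where "N * f c = c + p * (d * e)" using f C(1) c by blast
    then have "c = N * f c - d * (p * e)" by simp
    then show ?thesis using N(3) by (metis dvd_diff dvd_mult2 dvd_triv_left)
  qed
  have T_ne: "T \<noteq> {}" using d_dvd C(2) unfolding T_def by blast
  have rec: "\<exists>x\<in>T. \<exists>e\<in>E. N * y = x + p * e" if y: "y \<in> T" for y
  proof -
    obtain c where c: "c \<in> C" "d * y = f c" using y C(3) unfolding T_def by blast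
    obtain e where e: "e \<in> E" "N * f c = c + p * (d * e)" using f C(1) c(1) by blast
    obtain x where x: "c = d * x" using d_dvd[OF c(1)] by blast
    have "d * (N * y) = d * (x + p * e)" using c(2) e(2) x by (simp add: algebra_simps)
    then have "N * y = x + p * e" using N(2) by simp
    moreover have "x \<in> T" using c(1) x by (simp add: T_def)
    ultimately show ?thesis using e(1) by blast
  qed
  have fin: "finite T"
  proof (rule finite_imageD)
    show "finite ((\<lambda>z. d * z) ` T)" using T_S S(1) finite_subset by blast
  qed (use N(2) in \<open>auto simp: inj_on_def\<close>)
  \<comment> \<open>For the maximum, N * Max T = x + p * e \<le> Max T + p * hi.\<close>
  have upper: "(N - 1) * y \<le> p * hi" if y: "y \<in> T" for y
  proof -
    obtain x e where "x \<in> T" "e \<in> E" "N * Max T = x + p * e" using rec[OF Max_in[OF fin T_ne]] by blast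
    moreover from this have "x \<le> Max T" "p * e \<le> p * hi" using fin E p by simp_all
    ultimately have "(N - 1) * Max T \<le> p * hi" by (simp add: left_diff_distrib)
    moreover have "(N - 1) * y \<le> (N - 1) * Max T" using fin y N(1) by simp
    ultimately show ?thesis by simp
  qed
  have lower: "p * lo \<le> (N - 1) * y" if y: "y \<in> T" for y
  proof -
    obtain x e where "x \<in> T" "e \<in> E" "N * Min T = x + p * e" using rec[OF Min_in[OF fin T_ne]] by blast
    moreover from this have "Min T \<le> x" "p * lo \<le> p * e" using fin E p by simp_all
    ultimately have "p * lo \<le> (N - 1) * Min T" by (simp add: left_diff_distrib)
    moreover have "(N - 1) * Min T \<le> (N - 1) * y" using fin y N(1) by simp
    ultimately show ?thesis by simp
  qed
  show ?thesis by (intro exI[of _ T] conjI ballI T_ne T_S rec upper lower)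
qed

text \<open>The assumption \<open>gap\<close> says that no orbit of the digit system meets both \<open>(1/4, 1/2)\<close> and
  \<open>(1/2, 3/4)\<close> modulo 1 after division by \<open>p\<close>; every nonzero doubling orbit modulo \<open>p\<close> does.\<close>

lemma infinite_prime_eigenvalues:
  fixes N d M lo hi :: int and B E :: "int set"
  assumes N: "N = d * M" "N \<ge> 3" "d > 0"
    and B: "finite B" "0 \<in> B" "Gcd B = 1"
    and E: "finite E" "0 \<in> E" "card E = card B" "\<And>e. e \<in> E \<Longrightarrow> lo \<le> e \<and> e \<le> hi"
    and bounds: "- (N - 1) < lo" "hi < N - 1"
    and hadamard: "\<And>p b b'. coprime p N \<Longrightarrow> b \<in> B \<Longrightarrow> b' \<in> B \<Longrightarrow> b \<noteq> b' \<Longrightarrow>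
      (\<Sum>e\<in>E. expo (of_int (b - b')) (of_int (p * e) / of_int M)) = 0"
    and gap: "\<And>p T y z. p > 0 \<Longrightarrow> (\<And>y. y \<in> T \<Longrightarrow> \<exists>x\<in>T. \<exists>e\<in>E. N * y = x + p * e) \<Longrightarrow>
      (\<And>y. y \<in> T \<Longrightarrow> p * lo \<le> (N - 1) * y \<and> (N - 1) * y \<le> p * hi) \<Longrightarrow>
      y \<in> T \<Longrightarrow> p < 4 * (y mod p) \<Longrightarrow> 2 * (y mod p) < p \<Longrightarrow>
      z \<in> T \<Longrightarrow> p < 2 * (z mod p) \<Longrightarrow> 4 * (z mod p) < 3 * p \<Longrightarrow> False"
  shows "infinite {p::nat. prime p \<and>
    spectral_eigenvalue (self_similar_measure N B) (Lambda_set N ((\<lambda>e. d * e) ` E)) (real p)}"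
proof -
  have M: "M \<noteq> 0" using N by auto
  \<comment> \<open>The bounds confine the points strictly between -p and p, so 0 is the only
    multiple of \<open>p\<close> among them.\<close>
  have small: "y = 0" if py: "p > 0" "p dvd y" "p * lo \<le> (N - 1) * y" "(N - 1) * y \<le> p * hi" for p y :: int
  proof -
    obtain w where w: "y = p * w" using py(2) by blast
    have "p * lo \<le> p * ((N - 1) * w)" "p * ((N - 1) * w) \<le> p * hi"
      using that w by (simp_all add: mult.left_commute)
    then have "lo \<le> (N - 1) * w" "(N - 1) * w \<le> hi" using that(1) by simp_all
    then have "- (N - 1) < (N - 1) * w" and less: "(N - 1) * w < N - 1"
      using bounds less_le_trans le_less_trans by blast+
    then have "(N - 1) * (- 1) < (N - 1) * w" by (simp only: mult_minus1_right)
    then have "- 1 < w" by (rule mult_left_less_imp_less) (use N(2) in simp)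
    moreover have "(N - 1) * w < (N - 1) * 1" using less by (simp only: mult_1_right)
    then have "w < 1" by (rule mult_left_less_imp_less) (use N(2) in simp)
    ultimately show ?thesis using w by simp
  qed
  \<comment> \<open>The value p = 1 covers the original spectrum, where divisibility by
    \<open>p\<close> is trivial; the primes cover its multiples.\<close>
  have pair: "spectral_pair (self_similar_measure N B) ((*) (real_of_int p) ` Lambda_set N ((\<lambda>e. d * e) ` E))"
    if p: "p > 0" "coprime p N" "p = 1 \<or> prime p \<and> (\<exists>k. [N ^ k = 2] (mod p))" for p :: int
  proof -
    let ?L = "(\<lambda>l. p * l) ` (\<lambda>e. d * e) ` E"
    have L: "?L = (\<lambda>e. p * (d * e)) ` E" by (rule image_image)
    have inj: "inj_on (\<lambda>e. p * (d * e)) E" using p N by (auto simp: inj_on_def)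
    interpret cycle_free_ifs N B ?L
    proof
      show "N \<ge> 2" using N by simp
      show "card ?L = card B" unfolding L using card_image[OF inj] E by simp
      show "0 \<in> ?L" using E(2) unfolding L by force
      fix b b' assume b: "b \<in> B" "b' \<in> B" "b \<noteq> b'"
      have "real_of_int (p * (d * e)) / of_int N = of_int (p * e) / of_int M" for e
        using N M by (simp add: field_simps)
      then show "(\<Sum>l\<in>?L. expo (of_int (b - b')) (of_int l / of_int N)) = 0"
        unfolding L sum.reindex[OF inj] using hadamard[OF p(2) b] by simp
    next
      fix S :: "int set"
      assume S: "finite S" "S \<noteq> {}" and step: "\<And>x. x \<in> S \<Longrightarrow> \<exists>l\<in>?L. \<exists>y\<in>S. N * y = x + l"
      have step': "\<exists>e\<in>E. \<exists>y\<in>S. N * y = x + p * (d * e)" if "x \<in> S" for x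
        using step[OF that] unfolding L by blast
      have "d dvd N" using N(1) by simp
      have "\<exists>T. T \<noteq> {} \<and> (\<lambda>z. d * z) ` T \<subseteq> S \<and> (\<forall>y\<in>T. \<exists>x\<in>T. \<exists>e\<in>E. N * y = x + p * e) \<and>
          (\<forall>y\<in>T. p * lo \<le> (N - 1) * y \<and> (N - 1) * y \<le> p * hi)"
        by (rule periodic_points_bounds[OF N(2,3) \<open>d dvd N\<close> p(1) S]) (fact step', fact E(4))
      then obtain T where T: "T \<noteq> {}" "(\<lambda>z. d * z) ` T \<subseteq> S"
        "\<forall>y\<in>T. \<exists>x\<in>T. \<exists>e\<in>E. N * y = x + p * e"
        "\<forall>y\<in>T. p * lo \<le> (N - 1) * y \<and> (N - 1) * y \<le> p * hi"
        by (elim exE conjE)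
      note rec = T(3)[rule_format] and bd = T(4)[rule_format]
      have "\<forall>y\<in>T. p dvd y"
      proof (cases "p = 1")
        case False
        then obtain k where prime: "prime p" and k: "[N ^ k = 2] (mod p)" using p(3) by blast
        have "p \<noteq> 2"
        proof
          assume "p = 2"
          then have "p dvd N ^ k" using k by (simp add: cong_def dvd_eq_mod_eq_0)
          then have "p dvd N" using prime prime_dvd_power by blast
          then show False using p(2) prime by (meson coprime_absorb_left not_prime_unit)
        qed
        then have odd: "odd p" using prime prime_odd_int p(1) by (metis primes_dvd_imp_eq two_is_prime)
        \<comment> \<open>Going back along the cycle, the predecessor of y is N * y - p * e, so
          \<open>T\<close> is closed under multiplication by \<open>N\<close> modulo
          \<open>p\<close>.\<close>
        have pow: "\<exists>x\<in>T. [x = N ^ j * y] (mod p)" if "y \<in> T" for y j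
          using that
        proof (induction j arbitrary: y)
          case (Suc j)
          then obtain x e where x: "x \<in> T" "N * y = x + p * e" using rec by blast
          then have "[x = N * y] (mod p)" by (simp add: cong_def)
          then have "[N ^ j * x = N ^ Suc j * y] (mod p)"
            using cong_scalar_left by (fastforce simp: mult_ac)
          then show ?case using Suc.IH[OF x(1)] cong_trans by blast
        qed (auto intro!: bexI)
        have dbl: "\<exists>x\<in>T. [x = 2 * y] (mod p)" if "y \<in> T" for y
          using pow[OF that, of k] k cong_scalar_right cong_trans by blast
        show ?thesis
        proof (rule ccontr)
          assume "\<not> ?thesis"
          then obtain t where t: "t \<in> T" "\<not> p dvd t" by blast
          obtain y where y: "y \<in> T" "p < 4 * (y mod p)" "2 * (y mod p) < p"
            using doubling_residue_low[OF odd p(1) dbl t] by blast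
          obtain z where z: "z \<in> T" "p < 2 * (z mod p)" "4 * (z mod p) < 3 * p"
            using doubling_residue_high[OF odd p(1) dbl t] by blast
          show False by (rule gap[OF p(1) rec bd y z])
        qed
      qed auto
      then have "T \<subseteq> {0}" using small[OF p(1)] bd by blast
      then have "0 \<in> T" using T(1) by blast
      then show "0 \<in> S" using T(2) by force
    qed (use B E in auto)
    show ?thesis using spectral_pair unfolding Lambda_set_scale .
  qed
  have "{p::nat. prime p \<and> \<not> int p dvd N \<and> (\<exists>k. [N ^ k = 2] (mod int p))}
    \<subseteq> {p::nat. prime p \<and> spectral_eigenvalue (self_similar_measure N B) (Lambda_set N ((\<lambda>e. d * e) ` E)) (real p)}"
  proof (intro subsetI CollectI, elim CollectE conjE, intro conjI)
    fix p :: nat assume p: "prime p" "\<not> int p dvd N" "\<exists>k. [N ^ k = 2] (mod int p)"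
    have "coprime (int p) N" using p by (intro prime_imp_coprime) auto
    then have "spectral_pair (self_similar_measure N B) ((*) (real p) ` Lambda_set N ((\<lambda>e. d * e) ` E))"
      using pair[of "int p"] p prime_gt_0_nat by auto
    then show "spectral_eigenvalue (self_similar_measure N B) (Lambda_set N ((\<lambda>e. d * e) ` E)) (real p)"
      using pair[of 1] by (simp add: spectral_eigenvalue_def)
  qed
  then show ?thesis using infinite_primes_two_power[OF N(2)] infinite_super by blast
qed

section \<open>Verification for the three families of digit sets\<close>

lemma expo_odd_half:
  assumes "odd (a * c)"
  shows "expo (of_int a) (of_int c / 2) = - 1"
proof -
  obtain k where k: "a * c = 2 * k + 1" using assms by (elim oddE)
  have "expo (of_int a) (of_int c / 2) = expo 1 (of_int (a * c) / 2)"
    by (simp add: expo_eq_cis)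
  also have "\<dots> = expo 1 (of_int k) * expo 1 (1 / 2)"
    by (simp add: k add_divide_distrib flip: expo_add_right)
  also have "expo 1 (of_int k) = 1" by (simp add: expo_eq_1_iff)
  finally show ?thesis by (simp add: expo_eq_cis)
qed

text \<open>Nonnegative small digits confine the orbit to the interval from 0 to p/2, so no residue
  exceeds p/2.\<close>

lemma gap_nonneg_digits:
  fixes N p hi z :: int
  assumes "N \<ge> 3" "p > 0" "2 * hi \<le> N - 1" and z: "p * 0 \<le> (N - 1) * z" "(N - 1) * z \<le> p * hi"
    and r: "p < 2 * (z mod p)"
  shows False
proof -
  have z0: "0 \<le> z" using z(1) assms(1) by (simp add: zero_le_mult_iff)
  have "(N - 1) * (2 * z) \<le> p * (2 * hi)" using z(2) by simp
  also have "\<dots> \<le> p * (N - 1)" using assms by (intro mult_left_mono) auto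
  finally have "2 * z \<le> p" using assms(1) by (simp add: mult.commute[of p])
  moreover have "z mod p \<le> z" using z0 assms(2) by (simp add: zmod_le_nonneg_dividend)
  ultimately show False using r by simp
qed

text \<open>The orbit lies between -p/2 and p/4. Nonnegative points have residues at most p/4,
  negative ones at least p/2, and nothing falls strictly between.\<close>

lemma gap_mixed_digits:
  fixes N p lo hi y :: int
  assumes "N \<ge> 3" "p > 0" "4 * hi \<le> N - 1" "- (N - 1) \<le> 2 * lo"
    and y: "p * lo \<le> (N - 1) * y" "(N - 1) * y \<le> p * hi"
    and r: "p < 4 * (y mod p)" "2 * (y mod p) < p"
  shows False
proof (cases "y \<ge> 0")
  case True
  have "(N - 1) * (4 * y) \<le> p * (4 * hi)" using y(2) by simp
  also have "\<dots> \<le> p * (N - 1)" using assms by (intro mult_left_mono) auto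
  finally have "4 * y \<le> p" using assms(1) by (simp add: mult.commute[of p])
  moreover have "y mod p \<le> y" using True assms(2) by (simp add: zmod_le_nonneg_dividend)
  ultimately show False using r by simp
next
  case False
  have "(N - 1) * (- p) = p * (- (N - 1))" by (simp add: algebra_simps)
  also have "\<dots> \<le> p * (2 * lo)" using assms by (intro mult_left_mono) auto
  also have "\<dots> \<le> (N - 1) * (2 * y)" using y(1) by simp
  finally have "(N - 1) * (- p) \<le> (N - 1) * (2 * y)" .
  then have le: "- p \<le> 2 * y" by (rule mult_left_le_imp_le) (use assms(1) in simp)
  have "y mod p = (y + p) mod p" by simp
  also have "\<dots> = y + p" using False le assms(2) by (intro mod_pos_pos_trivial) auto
  finally show False using r le by simp
qed

text \<open>The shift \<open>lo\<close> covers both choices of digits. Since \<open>p\<close> is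
  odd, consecutive digits contribute opposite exponentials, which cancel.\<close>

lemma case_two_digits:
  fixes N q lo :: int
  assumes "q \<ge> 2" "N = 2 * q" "lo \<in> {0, -1}"
  shows "infinite {p::nat. prime p \<and>
    spectral_eigenvalue (self_similar_measure N {0, 1}) (Lambda_set N ((\<lambda>e. q * e) ` {lo, lo + 1})) (real p)}"
proof (rule infinite_prime_eigenvalues[where M = 2 and lo = lo and hi = "lo + 1"])
  fix p b b' :: int
  assume p: "coprime p N" and b: "b \<in> {0, 1}" "b' \<in> {0, 1}" "b \<noteq> b'"
  have "odd p" using p assms(2) by auto
  then have "odd ((b - b') * p)" using b by auto
  then have h: "expo (of_int (b - b')) (of_int p / 2) = - 1" by (rule expo_odd_half)
  have "expo (of_int (b - b')) (of_int (p * (lo + 1)) / of_int 2)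
      = expo (of_int (b - b')) (of_int (p * lo) / of_int 2) * expo (of_int (b - b')) (of_int p / 2)"
    by (simp add: distrib_left add_divide_distrib flip: expo_add_right)
  then show "(\<Sum>e\<in>{lo, lo + 1}. expo (of_int (b - b')) (of_int (p * e) / of_int 2)) = 0"
    unfolding h by simp
next
  fix p y z :: int and T
  assume p: "p > 0" and T: "\<And>y. y \<in> T \<Longrightarrow> p * lo \<le> (N - 1) * y \<and> (N - 1) * y \<le> p * (lo + 1)"
    and y: "y \<in> T" "p < 4 * (y mod p)" "2 * (y mod p) < p"
    and z: "z \<in> T" "p < 2 * (z mod p)" "4 * (z mod p) < 3 * p"
  show False
  proof (cases "lo = 0")
    case True
    then show False using gap_nonneg_digits[of N p 1 z] p T[OF z(1)] z assms by simp
  next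
    case False
    then show False using gap_mixed_digits[of N p 0 "-1" y] p T[OF y(1)] y assms by simp
  qed
qed (use assms in auto)

lemma case_three_digits:
  fixes N q a b lo :: int
  assumes q: "q \<ge> 2" "N = 3 * q" and lo: "lo \<in> {0, -1, -2}"
    and ab: "gcd a b = 1" "{a mod 3, b mod 3} = {1, 2}"
  shows "infinite {p::nat. prime p \<and>
    spectral_eigenvalue (self_similar_measure N {0, a, b}) (Lambda_set N ((\<lambda>e. q * e) ` {lo, lo + 1, lo + 2})) (real p)}"
proof (rule infinite_prime_eigenvalues[where M = 3 and lo = lo and hi = "lo + 2"])
  have ab3: "a mod 3 = 1 \<and> b mod 3 = 2 \<or> a mod 3 = 2 \<and> b mod 3 = 1"
    using ab(2) by (auto simp: doubleton_eq_iff)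
  then have ne: "a \<noteq> 0" "b \<noteq> 0" "a \<noteq> b" by auto
  show "card {lo, lo + 1, lo + 2} = card {0, a, b}" using ne by simp
  show "Gcd {0, a, b} = 1" using ab(1) by simp
  fix p c c' :: int
  assume p: "coprime p N" and c: "c \<in> {0, a, b}" "c' \<in> {0, a, b}" "c \<noteq> c'"
  have "\<not> 3 dvd p" using p q(2) by (metis coprime_common_divisor dvd_triv_left dvd_mult2 zdvd1_eq abs_numeral numeral_eq_one_iff semiring_norm(86))
  moreover have "\<not> 3 dvd c - c'" using ab3 c by (auto; presburger)
  moreover have "prime (3 :: int)" by simp
  ultimately have nd: "\<not> 3 dvd (c - c') * p" using prime_dvd_mult_iff by blast
  \<comment> \<open>As 3 does not divide (c - c') * p, this is a primitive cube root of unity, and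
    three consecutive digits give a multiple of 1 + w + w^2 = 0.\<close>
  define w where "w = expo (of_int (c - c')) (of_int p / 3)"
  have "w \<noteq> 1"
  proof
    assume "w = 1"
    then obtain k where "of_int (c - c') * (of_int p / 3) = real_of_int k"
      unfolding w_def expo_eq_1_iff by (elim Ints_cases)
    then have "real_of_int ((c - c') * p) = of_int (3 * k)" by simp
    then have "(c - c') * p = 3 * k" unfolding of_int_eq_iff .
    then show False using nd by simp
  qed
  moreover have "w ^ 3 = 1"
  proof -
    have "w ^ 3 = expo (of_int (c - c')) (of_int p)"
      by (simp add: w_def power3_eq_cube flip: expo_add_right)
    then show ?thesis by (simp add: expo_eq_1_iff)
  qed
  moreover have "(w - 1) * (1 + w + w * w) = w ^ 3 - 1" by (simp add: power3_eq_cube algebra_simps)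
  ultimately have w: "1 + w + w * w = 0" by simp
  define u where "u = expo (of_int (c - c')) (of_int (p * lo) / 3)"
  have "expo (of_int (c - c')) (of_int (p * (lo + 1)) / 3) = u * w"
    by (simp add: u_def w_def distrib_left add_divide_distrib flip: expo_add_right)
  moreover have "expo (of_int (c - c')) (of_int (p * (lo + 2)) / 3) = u * w * w"
  proof -
    have "real_of_int (p * (lo + 2)) / 3 = of_int (p * lo) / 3 + of_int p / 3 + of_int p / 3"
      by (simp add: field_simps)
    then show ?thesis unfolding u_def w_def by (simp only: expo_add_right)
  qed
  ultimately have "(\<Sum>e\<in>{lo, lo + 1, lo + 2}. expo (of_int (c - c')) (of_int (p * e) / of_int 3)) = u * (1 + w + w * w)"
    by (simp add: u_def algebra_simps)
  then show "(\<Sum>e\<in>{lo, lo + 1, lo + 2}. expo (of_int (c - c')) (of_int (p * e) / of_int 3)) = 0"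
    using w by simp
next
  fix p y z :: int and T
  assume p: "p > 0" and T: "\<And>y. y \<in> T \<Longrightarrow> p * lo \<le> (N - 1) * y \<and> (N - 1) * y \<le> p * (lo + 2)"
    and y: "y \<in> T" "p < 4 * (y mod p)" "2 * (y mod p) < p"
    and z: "z \<in> T" "p < 2 * (z mod p)" "4 * (z mod p) < 3 * p"
  show False
  proof (cases "lo = 0")
    case True
    then show False using gap_nonneg_digits[of N p 2 z] p T[OF z(1)] z q by simp
  next
    case False
    then show False using gap_mixed_digits[of N p "lo + 2" lo y] p T[OF y(1)] y q lo by auto
  qed
qed (use q lo in auto)

text \<open>The digits are all sums of an element of {0, 1} and one of {0, 2^m}, so the Hadamard sum
  factors as (1 + u)(1 + v), and one factor vanishes for each pair from \<open>B\<close>.\<close>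

lemma case_four_digits:
  fixes N a b b' :: int and m :: nat
  assumes m: "1 \<le> m" and pos: "0 < a" "0 < b" "0 < b'" and odd: "odd a" "odd b" "odd b'"
    and gcd: "gcd a (gcd b b') = 1" and N: "8 \<le> N" "2 ^ (m + 1) dvd N"
  shows "infinite {p::nat. prime p \<and>
    spectral_eigenvalue (self_similar_measure N {0, a, 2 ^ m * b, a + 2 ^ m * b'})
      (Lambda_set N ((\<lambda>x. N div 2 ^ (m + 1) * x) ` {0, 1, 2 ^ m, 1 + 2 ^ m})) (real p)}"
proof (rule infinite_prime_eigenvalues[where M = "2 ^ (m + 1)" and lo = 0 and hi = "1 + 2 ^ m"])
  let ?P = "2 ^ m :: int"
  have P: "?P \<ge> 2" "even ?P" using m by (auto simp: self_le_power)
  show "N = N div 2 ^ (m + 1) * 2 ^ (m + 1)" using N(2) by simp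
  show "0 < N div 2 ^ (m + 1)" using N by (simp add: pos_imp_zdiv_pos_iff zdvd_imp_le)
  have "?P * b > 0" "?P * b' > 0" "even (?P * b)" "even (?P * b')" using pos P(2) by simp_all
  then have ne: "a \<noteq> 0" "?P * b \<noteq> 0" "a \<noteq> ?P * b" "a + ?P * b' \<noteq> 0" "a + ?P * b' \<noteq> a" "a + ?P * b' \<noteq> ?P * b"
    using pos(1) odd(1) by - (linarith, linarith, metis, linarith, linarith, metis even_add)
  have "card {0, a, ?P * b, a + ?P * b'} = 4" using ne by simp
  moreover have "card {0, 1, x, 1 + x} = 4" if "x \<ge> 2" for x :: int using that by simp
  then have "card {0, 1, ?P, 1 + ?P} = 4" using P(1) by blast
  ultimately show "card {0, 1, ?P, 1 + ?P} = card {0, a, ?P * b, a + ?P * b'}" by simp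
  show "Gcd {0, a, ?P * b, a + ?P * b'} = 1"
  proof -
    have "Gcd {0, a, ?P * b, a + ?P * b'} dvd 1"
    proof -
      let ?g = "Gcd {0, a, ?P * b, a + ?P * b'}"
      \<comment> \<open>The common divisor divides the odd number \<open>a\<close>, so powers of 2
        can be cancelled and it divides \<open>b\<close> and \<open>b'\<close>.\<close>
      have g: "?g dvd a" "?g dvd ?P * b" "?g dvd a + ?P * b'" by (auto intro!: Gcd_dvd simp del: Gcd_insert)
      have "?g dvd ?P * b'" using g(1,3) dvd_add_right_iff by blast
      moreover have "coprime ?g ?P" using g(1) odd(1) by (metis coprime_divisors coprime_power_right_iff coprime_right_2_iff_odd dvd_refl)
      ultimately have "?g dvd b'" "?g dvd b" using g(2) by (simp_all add: coprime_dvd_mult_right_iff)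
      then have "?g dvd gcd a (gcd b b')" using g(1) by (intro gcd_greatest)
      then show ?thesis using gcd by simp
    qed
    then show ?thesis by (metis normalize_Gcd is_unit_normalize)
  qed
  have P_le: "2 * ?P \<le> N" using N zdvd_imp_le[OF N(2)] by simp
  show hi: "1 + ?P < N - 1" using P_le P(1) N(1) by linarith
  show "- (N - 1) < 0" using N by simp
  show "0 \<le> e \<and> e \<le> 1 + ?P" if "e \<in> {0, 1, ?P, 1 + ?P}" for e using that P(1) by auto
  {
    fix p c c' :: int
    assume p: "coprime p N" and c: "c \<in> {0, a, ?P * b, a + ?P * b'}" "c' \<in> {0, a, ?P * b, a + ?P * b'}" "c \<noteq> c'"
    have "even N" using N(2) by (metis dvd_trans dvd_triv_left power_Suc Suc_eq_plus1)
    then have oddp: "odd p" using p by auto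
    define F where "F e = expo (of_int (c - c')) (of_int (p * e) / of_int (2 ^ (m + 1)))" for e
    define u where "u = expo (of_int (c - c')) (of_int p / of_int (2 ^ (m + 1)))"
    define v where "v = expo (of_int (c - c')) (of_int p / 2)"
    have F: "F 0 = 1" "F 1 = u" "F ?P = v" by (simp_all add: F_def u_def v_def)
    have F_mult: "F (1 + ?P) = F 1 * F ?P"
      unfolding F_def by (simp add: distrib_left add_divide_distrib flip: expo_add_right)
    have "(\<Sum>e\<in>{0, 1, x, 1 + x}. F e) = F 0 + F 1 + F x + F (1 + x)" if "x \<ge> 2" for x
      using that by simp
    from this[OF P(1)] have "(\<Sum>e\<in>{0, 1, ?P, 1 + ?P}. F e) = 1 + u + v + u * v"
      unfolding F_mult F .
    then have sum: "(\<Sum>e\<in>{0, 1, ?P, 1 + ?P}. F e) = (1 + u) * (1 + v)" by (simp add: algebra_simps)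
    \<comment> \<open>Elements of different parity have an odd difference, which makes v = -1; the
      pairs of equal parity differ by 2^m times an odd number, which makes u = -1.\<close>
    have "odd (c - c') \<or> (\<exists>k. odd k \<and> c - c' = ?P * k)"
    proof -
      have 1: "\<exists>k. odd k \<and> ?P * b = ?P * k" "\<exists>k. odd k \<and> - (?P * b) = ?P * k"
        "\<exists>k. odd k \<and> ?P * b' = ?P * k" "\<exists>k. odd k \<and> - (?P * b') = ?P * k"
        using odd by (auto intro: exI[of _ b] exI[of _ "- b"] exI[of _ b'] exI[of _ "- b'"])
      show ?thesis using c odd P(2) 1 by auto
    qed
    then have "u = - 1 \<or> v = - 1"
    proof
      assume "odd (c - c')"
      then show ?thesis using expo_odd_half[of "c - c'" p] oddp by (simp add: v_def)
    next
      assume "\<exists>k. odd k \<and> c - c' = ?P * k"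
      then obtain k where k: "odd k" "c - c' = ?P * k" by blast
      have "u = expo (of_int k) (of_int p / 2)" unfolding u_def k(2) by (simp add: expo_eq_cis)
      then show ?thesis using expo_odd_half[of k p] oddp k(1) by simp
    qed
    then show "(\<Sum>e\<in>{0, 1, ?P, 1 + ?P}. expo (of_int (c - c')) (of_int (p * e) / of_int (2 ^ (m + 1)))) = 0"
      using sum unfolding F_def by auto
  }
  fix p y z :: int and T
  assume p: "p > 0" and rec: "\<And>y. y \<in> T \<Longrightarrow> \<exists>x\<in>T. \<exists>e\<in>{0, 1, ?P, 1 + ?P}. N * y = x + p * e"
    and T: "\<And>y. y \<in> T \<Longrightarrow> p * 0 \<le> (N - 1) * y \<and> (N - 1) * y \<le> p * (1 + ?P)"
    and y: "y \<in> T" "p < 4 * (y mod p)" "2 * (y mod p) < p"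
    and z: "z \<in> T" "p < 2 * (z mod p)" "4 * (z mod p) < 3 * p"
  \<comment> \<open>The orbit stays within one period, so its points coincide with their residues
    modulo \<open>p\<close>.\<close>
  have below: "0 \<le> x" "x < p" if "x \<in> T" for x
  proof -
    show "0 \<le> x" using T[OF that] N(1) by (simp add: zero_le_mult_iff)
    have "(N - 1) * x < (N - 1) * p"
      using T[OF that] mult_strict_left_mono[OF hi p] by (simp add: mult.commute)
    then show "x < p" using N(1) by simp
  qed
  show False
  proof (cases "N = 2 * ?P")
    case False
    \<comment> \<open>If N is at least 4 * 2^m, the largest digit is small enough to keep the orbit
      below p/2.\<close>
    obtain k where k: "N = 2 * ?P * k" using N(2) by (auto elim: dvdE)
    have "0 < 2 * ?P * k" using k N(1) by linarith
    then have "0 < k" using P(1) by (simp add: zero_less_mult_iff)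
    moreover have "k \<noteq> 1" using k False by auto
    ultimately have "k \<ge> 2" by linarith
    then have "2 * ?P * 2 \<le> N" unfolding k using P(1) by (intro mult_left_mono) auto
    then have "2 * (1 + ?P) \<le> N - 1" using P(1) by (smt (verit))
    then show False using gap_nonneg_digits[of N p "1 + ?P" z] p T[OF z(1)] z N(1) by simp
  next
    case True
    text \<open>Here the attractor reaches beyond 1/2, but its part below 1/2 lies below 1/4.\<close>
    have y_mod: "y mod p = y" using below[OF y(1)] by simp
    obtain x e where x: "x \<in> T" "e \<in> {0, 1, ?P, 1 + ?P}" "N * y = x + p * e" using rec[OF y(1)] by blast
    have "e \<le> 1 \<or> e \<ge> ?P" using x(2) by auto
    then show False
    proof
      \<comment> \<open>A small last digit gives N * y < 2 * p, and N \<ge> 8 puts \<open>y\<close>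
        below p/4; a large one will put it at p/2 or above.\<close>
      assume "e \<le> 1"
      then have "p * e \<le> p * 1" using p by (intro mult_left_mono) auto
      then have "p * e \<le> p" by (simp only: mult_1_right)
      then have "N * y < 2 * p" using x(3) below(2)[OF x(1)] by linarith
      moreover have "8 * y \<le> N * y" using N(1) below[OF y(1)] by (intro mult_right_mono)
      ultimately show False using y(2) y_mod by simp
    next
      assume "e \<ge> ?P"
      then have "p * ?P \<le> p * e" using p by (intro mult_left_mono) auto
      also have "\<dots> \<le> N * y" using x(3) below(1)[OF x(1)] by linarith
      also have "\<dots> = ?P * (2 * y)" unfolding True by simp
      finally have "?P * p \<le> ?P * (2 * y)" by (simp only: mult.commute)
      then have "p \<le> 2 * y" using P(1) by simp
      then show False using y(3) y_mod by simp
    qed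
  qed
qed (use N in auto)

theorem corollary1p5:
  fixes N :: int and B L :: "int set"
  assumes
    "(\<exists>q::int. 2 \<le> q \<and> N = 2 * q \<and> B = {0, 1} \<and> (L = {0, q} \<or> L = {-q, 0}))
     \<or> (\<exists>q a b :: int. 2 \<le> q \<and> N = 3 * q \<and> B = {0, a, b} \<and> gcd a b = 1 \<and>
          {a mod 3, b mod 3} = {1, 2} \<and>
          (L = {0, q, 2 * q} \<or> L = {-q, 0, q} \<or> L = {- 2 * q, -q, 0}))
     \<or> (\<exists>(m::nat) (a::int) (b::int) (b'::int).
          1 \<le> m \<and> 0 < a \<and> 0 < b \<and> 0 < b' \<and> odd a \<and> odd b \<and> odd b' \<and>
          gcd a (gcd b b') = 1 \<and>
          B = {0, a, 2 ^ m * b, a + 2 ^ m * b'} \<and>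
          8 \<le> N \<and> 2 ^ (m + 1) dvd N \<and>
          L = (\<lambda>x. N div 2 ^ (m + 1) * x) ` {0, 1, 2 ^ m, 1 + 2 ^ m})"
  shows "infinite {p::nat. prime p \<and>
           spectral_eigenvalue (self_similar_measure N B) (Lambda_set N L) (real p)}"
  using assms
proof (elim disjE exE conjE)
  fix q assume h: "2 \<le> q" "N = 2 * q" "B = {0, 1}" "L = {0, q}"
  have "L = (\<lambda>e. q * e) ` {0, 0 + 1}" using h by (simp add: mult.commute)
  then show ?thesis using case_two_digits[of q N 0] h by simp
next
  fix q assume h: "2 \<le> q" "N = 2 * q" "B = {0, 1}" "L = {- q, 0}"
  have "L = (\<lambda>e. q * e) ` {- 1, - 1 + 1}" using h by (simp add: mult.commute)
  then show ?thesis using case_two_digits[of q N "- 1"] h by simp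
next
  fix q a b assume h: "2 \<le> q" "N = 3 * q" "B = {0, a, b}" "gcd a b = 1" "{a mod 3, b mod 3} = {1, 2}" "L = {0, q, 2 * q}"
  have "L = (\<lambda>e. q * e) ` {0, 0 + 1, 0 + 2}" using h by (simp add: mult.commute)
  then show ?thesis using case_three_digits[OF h(1,2) _ h(4,5), of 0] h(3) by simp
next
  fix q a b assume h: "2 \<le> q" "N = 3 * q" "B = {0, a, b}" "gcd a b = 1" "{a mod 3, b mod 3} = {1, 2}" "L = {- q, 0, q}"
  have "L = (\<lambda>e. q * e) ` {- 1, - 1 + 1, - 1 + 2}" using h by (simp add: mult.commute)
  then show ?thesis using case_three_digits[OF h(1,2) _ h(4,5), of "- 1"] h(3) by simp
next
  fix q a b assume h: "2 \<le> q" "N = 3 * q" "B = {0, a, b}" "gcd a b = 1" "{a mod 3, b mod 3} = {1, 2}" "L = {- 2 * q, - q, 0}"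
  have "L = (\<lambda>e. q * e) ` {- 2, - 2 + 1, - 2 + 2}" using h by (simp add: mult.commute)
  then show ?thesis using case_three_digits[OF h(1,2) _ h(4,5), of "- 2"] h(3) by simp
next
  fix m :: nat and a b b' :: int
  assume h: "1 \<le> m" "0 < a" "0 < b" "0 < b'" "odd a" "odd b" "odd b'" "gcd a (gcd b b') = 1"
    "B = {0, a, 2 ^ m * b, a + 2 ^ m * b'}" "8 \<le> N" "2 ^ (m + 1) dvd N"
    "L = (\<lambda>x. N div 2 ^ (m + 1) * x) ` {0, 1, 2 ^ m, 1 + 2 ^ m}"
  show ?thesis unfolding h(9,12) by (rule case_four_digits[OF h(1-8,10,11)])
qed

end
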